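(* Let $G$ be a unimodular locally compact group and let $f\in C_c(G)$. Then the spectrum of the operator $\lambda_2(f): L^2(G)\to L^2(G)$ consists entirely of approximate eigenvalues.
   Context: Fix a left Haar measure on $G$. $C_c(G)$ is the space of continuous compactly supported functions $G\to\mathbb{C}$. For $f\in C_c(G)$, $\lambda_2(f)\in\mathcal{B}(L^2(G))$ is the operator $\lambda_2(f)(h)=f*h$ (left convolution by $f$, i.e. $f$ integrated against the left regular representation). A complex number $z$ is an approximate eigenvalue of a bounded operator $T$ on a Banach space if there is a sequence of unit vectors $\xi_n$ with $\|T\xi_n-z\xi_n\|\to 0$. *)

theory Defs
  imports "HOL-Analysis.Analysis"
begin

(* Topological groups are types of class topological_group_add. That class does not assume
   commutativity; the group law is written additively, so the product y^(-1) x is "- y + x". *)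

definition left_invariant :: "'a::topological_group_add measure \<Rightarrow> bool" where
  "left_invariant \<mu> \<longleftrightarrow> (\<forall>x. \<forall>A\<in>sets borel. emeasure \<mu> ((\<lambda>y. x + y) ` A) = emeasure \<mu> A)"

definition right_invariant :: "'a::topological_group_add measure \<Rightarrow> bool" where
  "right_invariant \<mu> \<longleftrightarrow> (\<forall>x. \<forall>A\<in>sets borel. emeasure \<mu> ((\<lambda>y. y + x) ` A) = emeasure \<mu> A)"

(* The group need not be sigma-compact, so the regularity conditions are those of a general
   Radon measure: outer regular on Borel sets, inner regular on open sets. *)
definition radon_measure :: "'a::t2_space measure \<Rightarrow> bool" where
  "radon_measure \<mu> \<longleftrightarrow>
     sets \<mu> = sets borel \<and>
     (\<forall>K. compact K \<longrightarrow> emeasure \<mu> K < \<infinity>) \<and>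
     (\<forall>A\<in>sets borel. emeasure \<mu> A = (INF U\<in>{U. open U \<and> A \<subseteq> U}. emeasure \<mu> U)) \<and>
     (\<forall>U. open U \<longrightarrow> emeasure \<mu> U = (SUP K\<in>{K. compact K \<and> K \<subseteq> U}. emeasure \<mu> K))"

definition left_haar_measure :: "'a::{topological_group_add,t2_space} measure \<Rightarrow> bool" where
  "left_haar_measure \<mu> \<longleftrightarrow> radon_measure \<mu> \<and> emeasure \<mu> UNIV \<noteq> 0 \<and> left_invariant \<mu>"

definition unimodular :: "'a::{topological_group_add,t2_space} itself \<Rightarrow> bool" where
  "unimodular (_ :: 'a itself) \<longleftrightarrow>
     (\<forall>\<mu> :: 'a measure. left_haar_measure \<mu> \<longrightarrow> right_invariant \<mu>)"

definition Cc :: "('a::topological_space \<Rightarrow> complex) set" where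
  "Cc = {f. continuous_on UNIV f \<and> compact (closure {x. f x \<noteq> 0})}"


(* Elements of L2_space are classes of functions modulo equality almost everywhere. *)

definition sq_integrable :: "'a measure \<Rightarrow> ('a \<Rightarrow> complex) set" where
  "sq_integrable \<mu> = {h \<in> borel_measurable \<mu>. integrable \<mu> (\<lambda>x. (cmod (h x))\<^sup>2)}"

definition ae_eq :: "'a measure \<Rightarrow> (('a \<Rightarrow> complex) \<times> ('a \<Rightarrow> complex)) set" where
  "ae_eq \<mu> = {(g, h). g \<in> sq_integrable \<mu> \<and> h \<in> sq_integrable \<mu> \<and> (AE x in \<mu>. g x = h x)}"

definition L2_space :: "'a measure \<Rightarrow> ('a \<Rightarrow> complex) set set" where
  "L2_space \<mu> = sq_integrable \<mu> // ae_eq \<mu>"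

definition L2_class :: "'a measure \<Rightarrow> ('a \<Rightarrow> complex) \<Rightarrow> ('a \<Rightarrow> complex) set" where
  "L2_class \<mu> h = ae_eq \<mu> `` {h}"

definition L2_add ::
  "'a measure \<Rightarrow> ('a \<Rightarrow> complex) set \<Rightarrow> ('a \<Rightarrow> complex) set \<Rightarrow> ('a \<Rightarrow> complex) set" where
  "L2_add \<mu> a b = (\<Union>g\<in>a. \<Union>h\<in>b. L2_class \<mu> (\<lambda>x. g x + h x))"

definition L2_scale ::
  "'a measure \<Rightarrow> complex \<Rightarrow> ('a \<Rightarrow> complex) set \<Rightarrow> ('a \<Rightarrow> complex) set" where
  "L2_scale \<mu> c a = (\<Union>g\<in>a. L2_class \<mu> (\<lambda>x. c * g x))"

definition L2_diff ::
  "'a measure \<Rightarrow> ('a \<Rightarrow> complex) set \<Rightarrow> ('a \<Rightarrow> complex) set \<Rightarrow> ('a \<Rightarrow> complex) set" where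
  "L2_diff \<mu> a b = L2_add \<mu> a (L2_scale \<mu> (- 1) b)"

definition L2_norm :: "'a measure \<Rightarrow> ('a \<Rightarrow> complex) set \<Rightarrow> real" where
  "L2_norm \<mu> a = the_elem ((\<lambda>h. sqrt (LINT x|\<mu>. (cmod (h x))\<^sup>2)) ` a)"

lemma equiv_ae_eq: "equiv (sq_integrable \<mu>) (ae_eq \<mu>)"
proof (rule equivI)
  show "ae_eq \<mu> \<subseteq> sq_integrable \<mu> \<times> sq_integrable \<mu>"
    unfolding ae_eq_def by blast
  show "refl_on (sq_integrable \<mu>) (ae_eq \<mu>)"
    by (simp add: ae_eq_def refl_on_def)
  show "sym (ae_eq \<mu>)"
    by (simp add: ae_eq_def sym_def eq_commute)
  show "trans (ae_eq \<mu>)"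
  proof (rule transI)
    fix g h k assume gh: "(g, h) \<in> ae_eq \<mu>" and hk: "(h, k) \<in> ae_eq \<mu>"
    have "AE x in \<mu>. g x = h x" "AE x in \<mu>. h x = k x"
      using gh hk by (simp_all add: ae_eq_def)
    then have "AE x in \<mu>. g x = k x"
      by eventually_elim simp
    then show "(g, k) \<in> ae_eq \<mu>"
      using gh hk by (simp add: ae_eq_def)
  qed
qed

lemma L2_class_eqI:
  "g \<in> sq_integrable \<mu> \<Longrightarrow> h \<in> sq_integrable \<mu> \<Longrightarrow> AE x in \<mu>. g x = h x \<Longrightarrow> L2_class \<mu> g = L2_class \<mu> h"
  unfolding L2_class_def by (rule equiv_class_eq[OF equiv_ae_eq]) (simp add: ae_eq_def)

lemma mem_L2_class_iff:
  "g \<in> sq_integrable \<mu> \<Longrightarrow>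
   h \<in> L2_class \<mu> g \<longleftrightarrow> h \<in> sq_integrable \<mu> \<and> (AE x in \<mu>. g x = h x)"
  by (auto simp: L2_class_def ae_eq_def)

lemma L2_class_self: "g \<in> sq_integrable \<mu> \<Longrightarrow> g \<in> L2_class \<mu> g"
  by (simp add: mem_L2_class_iff)

lemma sq_integrable_scale: "h \<in> sq_integrable \<mu> \<Longrightarrow> (\<lambda>x. c * h x) \<in> sq_integrable \<mu>"
  by (auto simp: sq_integrable_def norm_mult power_mult_distrib)

lemma sq_integrable_add:
  assumes "g \<in> sq_integrable \<mu>" "h \<in> sq_integrable \<mu>"
  shows "(\<lambda>x. g x + h x) \<in> sq_integrable \<mu>"
proof -
  have [measurable]: "g \<in> borel_measurable \<mu>" "h \<in> borel_measurable \<mu>"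
    using assms by (auto simp: sq_integrable_def)
  have bound: "(cmod (g x + h x))\<^sup>2 \<le> 2 * (cmod (g x))\<^sup>2 + 2 * (cmod (h x))\<^sup>2" for x
  proof -
    have "(cmod (g x + h x))\<^sup>2 \<le> (cmod (g x) + cmod (h x))\<^sup>2"
      by (intro power_mono norm_triangle_ineq) auto
    also have "\<dots> \<le> 2 * (cmod (g x))\<^sup>2 + 2 * (cmod (h x))\<^sup>2"
      using zero_le_power2[of "cmod (g x) - cmod (h x)"] by (simp add: power2_eq_square algebra_simps)
    finally show ?thesis .
  qed
  have "integrable \<mu> (\<lambda>x. 2 * (cmod (g x))\<^sup>2 + 2 * (cmod (h x))\<^sup>2)"
    using assms by (auto simp: sq_integrable_def)
  then have "integrable \<mu> (\<lambda>x. (cmod (g x + h x))\<^sup>2)"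
    by (rule Bochner_Integration.integrable_bound) (use bound in auto)
  then show ?thesis by (simp add: sq_integrable_def)
qed

lemma L2_add_class:
  assumes "g \<in> sq_integrable \<mu>" "h \<in> sq_integrable \<mu>"
  shows "L2_add \<mu> (L2_class \<mu> g) (L2_class \<mu> h) = L2_class \<mu> (\<lambda>x. g x + h x)"
proof -
  have "L2_class \<mu> (\<lambda>x. g' x + h' x) = L2_class \<mu> (\<lambda>x. g x + h x)"
    if g': "g' \<in> L2_class \<mu> g" and h': "h' \<in> L2_class \<mu> h" for g' h'
  proof (rule L2_class_eqI)
    have *: "g' \<in> sq_integrable \<mu>" "AE x in \<mu>. g x = g' x"
        "h' \<in> sq_integrable \<mu>" "AE x in \<mu>. h x = h' x"
      using g' h' mem_L2_class_iff[OF assms(1)] mem_L2_class_iff[OF assms(2)] by blast+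
    show "(\<lambda>x. g' x + h' x) \<in> sq_integrable \<mu>" "(\<lambda>x. g x + h x) \<in> sq_integrable \<mu>"
      by (rule sq_integrable_add; fact)+
    show "AE x in \<mu>. g' x + h' x = g x + h x"
      using *(2,4) by eventually_elim simp
  qed
  then show ?thesis
    using L2_class_self[OF assms(1)] L2_class_self[OF assms(2)] unfolding L2_add_def by blast
qed

lemma L2_scale_class:
  assumes "g \<in> sq_integrable \<mu>"
  shows "L2_scale \<mu> c (L2_class \<mu> g) = L2_class \<mu> (\<lambda>x. c * g x)"
proof -
  have "L2_class \<mu> (\<lambda>x. c * g' x) = L2_class \<mu> (\<lambda>x. c * g x)"
    if g': "g' \<in> L2_class \<mu> g" for g'
  proof (rule L2_class_eqI)
    have *: "g' \<in> sq_integrable \<mu>" "AE x in \<mu>. g x = g' x"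
      using g' mem_L2_class_iff[OF assms] by blast+
    show "(\<lambda>x. c * g' x) \<in> sq_integrable \<mu>" "(\<lambda>x. c * g x) \<in> sq_integrable \<mu>"
      by (rule sq_integrable_scale; fact)+
    show "AE x in \<mu>. c * g' x = c * g x"
      using *(2) by eventually_elim simp
  qed
  then show ?thesis
    using L2_class_self[OF assms] unfolding L2_scale_def by blast
qed

lemma L2_norm_class:
  assumes "g \<in> sq_integrable \<mu>"
  shows "L2_norm \<mu> (L2_class \<mu> g) = sqrt (LINT x|\<mu>. (cmod (g x))\<^sup>2)"
  unfolding L2_norm_def
proof (rule the_elem_image_unique)
  show "L2_class \<mu> g \<noteq> {}"
    using L2_class_self[OF assms] by blast
  fix h assume "h \<in> L2_class \<mu> g"
  then have h: "h \<in> sq_integrable \<mu>" and eq: "AE x in \<mu>. g x = h x"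
    using mem_L2_class_iff[OF assms] by blast+
  have [measurable]: "g \<in> borel_measurable \<mu>" "h \<in> borel_measurable \<mu>"
    using assms h by (simp_all add: sq_integrable_def)
  have "AE x in \<mu>. (cmod (h x))\<^sup>2 = (cmod (g x))\<^sup>2"
    using eq by eventually_elim simp
  then have "(LINT x|\<mu>. (cmod (h x))\<^sup>2) = (LINT x|\<mu>. (cmod (g x))\<^sup>2)"
    by (intro integral_cong_AE) measurable
  then show "sqrt (LINT x|\<mu>. (cmod (h x))\<^sup>2) = sqrt (LINT x|\<mu>. (cmod (g x))\<^sup>2)"
    by simp
qed


definition bounded_L2_operator ::
  "'a measure \<Rightarrow> (('a \<Rightarrow> complex) set \<Rightarrow> ('a \<Rightarrow> complex) set) \<Rightarrow> bool" where
  "bounded_L2_operator \<mu> T \<longleftrightarrow>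
     (\<forall>a\<in>L2_space \<mu>. T a \<in> L2_space \<mu>) \<and>
     (\<forall>a\<in>L2_space \<mu>. \<forall>b\<in>L2_space \<mu>. T (L2_add \<mu> a b) = L2_add \<mu> (T a) (T b)) \<and>
     (\<forall>c. \<forall>a\<in>L2_space \<mu>. T (L2_scale \<mu> c a) = L2_scale \<mu> c (T a)) \<and>
     (\<exists>C. \<forall>a\<in>L2_space \<mu>. L2_norm \<mu> (T a) \<le> C * L2_norm \<mu> a)"

definition shifted ::
  "'a measure \<Rightarrow> (('a \<Rightarrow> complex) set \<Rightarrow> ('a \<Rightarrow> complex) set) \<Rightarrow> complex
     \<Rightarrow> ('a \<Rightarrow> complex) set \<Rightarrow> ('a \<Rightarrow> complex) set" where
  "shifted \<mu> T z a = L2_diff \<mu> (T a) (L2_scale \<mu> z a)"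

definition L2_spectrum ::
  "'a measure \<Rightarrow> (('a \<Rightarrow> complex) set \<Rightarrow> ('a \<Rightarrow> complex) set) \<Rightarrow> complex set" where
  "L2_spectrum \<mu> T =
     {z. \<not> (\<exists>S. bounded_L2_operator \<mu> S \<and>
               (\<forall>a\<in>L2_space \<mu>. S (shifted \<mu> T z a) = a \<and> shifted \<mu> T z (S a) = a))}"

definition approximate_eigenvalue ::
  "'a measure \<Rightarrow> (('a \<Rightarrow> complex) set \<Rightarrow> ('a \<Rightarrow> complex) set) \<Rightarrow> complex \<Rightarrow> bool" where
  "approximate_eigenvalue \<mu> T z \<longleftrightarrow>
     (\<exists>\<xi> :: nat \<Rightarrow> ('a \<Rightarrow> complex) set.
        (\<forall>n. \<xi> n \<in> L2_space \<mu> \<and> L2_norm \<mu> (\<xi> n) = 1) \<and>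
        (\<lambda>n. L2_norm \<mu> (shifted \<mu> T z (\<xi> n))) \<longlonglongrightarrow> 0)"


definition convolution ::
  "'a::topological_group_add measure \<Rightarrow> ('a \<Rightarrow> complex) \<Rightarrow> ('a \<Rightarrow> complex) \<Rightarrow> 'a \<Rightarrow> complex" where
  "convolution \<mu> f h = (\<lambda>x. LINT y|\<mu>. f y * h (- y + x))"

(* Left convolution on classes. For a left Haar measure of a unimodular group and f in Cc,
   the function f * h is defined everywhere and does not depend on the representative h. *)
definition lambda2 ::
  "'a::topological_group_add measure \<Rightarrow> ('a \<Rightarrow> complex)
     \<Rightarrow> ('a \<Rightarrow> complex) set \<Rightarrow> ('a \<Rightarrow> complex) set" where
  "lambda2 \<mu> f a = (\<Union>h\<in>a. L2_class \<mu> (convolution \<mu> f h))"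

end

theory Submission
  imports Defs
begin

text \<open>
  Suppose that \<open>z\<close> is not an approximate eigenvalue, so that \<open>A = \<lambda>\<^sub>2(f) - z\<close> is bounded below; it
  has to be shown that \<open>A\<close> is onto. Formally, the projection onto the orthogonal complement of the
  range of \<open>A\<close> is \<open>1 - A (A\<^sup>* A)\<inverse> A\<^sup>*\<close>, and it has trace zero for the Plancherel trace \<open>\<phi> \<mapsto> \<phi>(e)\<close>. To
  avoid von Neumann algebras, the inverse is replaced by the polynomials in \<open>A\<^sup>* A\<close> given by the
  Neumann series, corrected by a fixed factor such that every operator that occurs is convolution
  by an element of \<open>C\<^sub>c(G)\<close>. Unimodularity enters through the trace property and through the
  bound \<open>\<parallel>k * \<phi>\<parallel>\<^sub>2 \<le> \<parallel>k\<parallel>\<^sub>2 \<parallel>\<phi>\<parallel>\<^sub>1\<close>. The correcting factor is \<open>1 - A\<^sup>* A / |z|\<^sup>2\<close> if \<open>z \<noteq> 0\<close>. If \<open>z = 0\<close>,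
  then \<open>G\<close> is discrete (otherwise, functions of small support show that \<open>\<lambda>\<^sub>2(f)\<close> is not bounded below),
  and no correction is needed since \<open>C\<^sub>c(G)\<close> has a unit.
\<close>

section \<open>Square-integrable functions\<close>

text \<open>Write A' for the adjoint of A. Unless G is discrete, the identity is not convolution by
  a function, whereas C_c(G) is an ideal in the algebra obtained by adjoining a unit. So a
  polynomial p in A' A is convolution by an element of C_c(G) as soon as its scalar part vanishes.
  As A' A has scalar part |z|^2, this condition reads p(|z|^2) = 0, while p(0) = 1 is what makes 1 -
  p(A A') divisible by A on the left. For nonzero z the factor 1 - t / |z|^2 reconciles the two
  conditions; for z = 0 they contradict each other, and only discreteness of G helps. The Haar
  measure need not be sigma-finite, so integrals are interchanged only for continuous kernels of
  compact support, and the density argument runs in C_c(G). General functions in L^2 are then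
  reached as limits, and classes modulo null sets only at the very end.\<close>

definition l2norm :: "'a measure \<Rightarrow> ('a \<Rightarrow> complex) \<Rightarrow> real" where
  "l2norm M h = sqrt (LINT x|M. (cmod (h x))\<^sup>2)"

definition l2inner :: "'a measure \<Rightarrow> ('a \<Rightarrow> complex) \<Rightarrow> ('a \<Rightarrow> complex) \<Rightarrow> complex" where
  "l2inner M g h = (LINT x|M. g x * cnj (h x))"

lemma sq_integrableD:
  assumes "h \<in> sq_integrable M"
  shows "h \<in> borel_measurable M" "integrable M (\<lambda>x. (cmod (h x))\<^sup>2)"
  using assms by (auto simp: sq_integrable_def)

lemma l2norm_nonneg [simp]: "0 \<le> l2norm M h"
  by (simp add: l2norm_def)

lemma l2norm_power2: "(l2norm M h)\<^sup>2 = (LINT x|M. (cmod (h x))\<^sup>2)"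
  by (simp add: l2norm_def)

lemma nn_integral_l2norm:
  assumes "h \<in> sq_integrable M"
  shows "(\<integral>\<^sup>+x. ennreal ((cmod (h x))\<^sup>2) \<partial>M) = ennreal ((l2norm M h)\<^sup>2)"
  unfolding l2norm_power2 by (rule nn_integral_eq_integral) (use sq_integrableD[OF assms] in auto)

text \<open>A bound on the nonnegative integral yields integrability and the norm estimate together;
  this is the form in which Fatou's lemma delivers its result.\<close>

lemma sq_integrable_nnI:
  assumes "h \<in> borel_measurable M" "(\<integral>\<^sup>+x. ennreal ((cmod (h x))\<^sup>2) \<partial>M) \<le> ennreal (C\<^sup>2)" "0 \<le> C"
  shows "h \<in> sq_integrable M" "l2norm M h \<le> C"
proof -
  have [measurable]: "h \<in> borel_measurable M" by fact
  have "(\<integral>\<^sup>+x. ennreal ((cmod (h x))\<^sup>2) \<partial>M) < \<infinity>"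
    using assms(2) by (rule le_less_trans) simp
  then show *: "h \<in> sq_integrable M"
    by (auto simp: sq_integrable_def integrable_iff_bounded)
  have "(l2norm M h)\<^sup>2 \<le> C\<^sup>2"
    using assms(2,3) nn_integral_l2norm[OF *] by simp
  then show "l2norm M h \<le> C" using \<open>0 \<le> C\<close> by (rule power2_le_imp_le)
qed

lemma sq_integrable_diff:
  assumes "g \<in> sq_integrable M" "h \<in> sq_integrable M"
  shows "(\<lambda>x. g x - h x) \<in> sq_integrable M"
  using sq_integrable_add[OF assms(1) sq_integrable_scale[OF assms(2), of "-1"]] by simp

text \<open>Cauchy-Schwarz is applied to extended nonnegative integrals, where nothing has to be
  integrable beforehand; finiteness of the bound then gives integrability of the product.\<close>

lemma sq_integrable_cmod_mult:
  assumes "g \<in> sq_integrable M" "h \<in> sq_integrable M"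
  shows "integrable M (\<lambda>x. cmod (g x) * cmod (h x))"
    and "(LINT x|M. cmod (g x) * cmod (h x)) \<le> l2norm M g * l2norm M h"
proof -
  note [measurable] = sq_integrableD(1)[OF assms(1)] sq_integrableD(1)[OF assms(2)]
  have *: "(\<integral>\<^sup>+x. ennreal (cmod (g x) * cmod (h x)) \<partial>M)\<^sup>2 \<le> ennreal ((l2norm M g * l2norm M h)\<^sup>2)"
    using Cauchy_Schwarz_nn_integral[of "\<lambda>x. ennreal (cmod (g x))" M "\<lambda>x. ennreal (cmod (h x))"]
    by (simp add: ennreal_mult ennreal_power nn_integral_l2norm[OF assms(1)]
        nn_integral_l2norm[OF assms(2)] power_mult_distrib)
  then have "(\<integral>\<^sup>+x. ennreal (cmod (g x) * cmod (h x)) \<partial>M)\<^sup>2 < \<infinity>"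
    by (rule le_less_trans) simp
  then have fin: "(\<integral>\<^sup>+x. ennreal (cmod (g x) * cmod (h x)) \<partial>M) < \<infinity>"
    by (auto simp: power2_eq_square less_top[symmetric] ennreal_mult_eq_top_iff)
  then show int: "integrable M (\<lambda>x. cmod (g x) * cmod (h x))"
    by (auto simp: integrable_iff_bounded abs_mult)
  have "(\<integral>\<^sup>+x. ennreal (cmod (g x) * cmod (h x)) \<partial>M) = ennreal (LINT x|M. cmod (g x) * cmod (h x))"
    by (rule nn_integral_eq_integral[OF int]) auto
  then have "(LINT x|M. cmod (g x) * cmod (h x))\<^sup>2 \<le> (l2norm M g * l2norm M h)\<^sup>2"
    using * by (simp add: ennreal_power)
  then show "(LINT x|M. cmod (g x) * cmod (h x)) \<le> l2norm M g * l2norm M h"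
    by (rule power2_le_imp_le) auto
qed

lemma integrable_mult_sq_integrable:
  assumes "g \<in> sq_integrable M" "h \<in> sq_integrable M"
  shows "integrable M (\<lambda>x. g x * h x)"
proof -
  note [measurable] = sq_integrableD(1)[OF assms(1)] sq_integrableD(1)[OF assms(2)]
  show ?thesis
    by (rule Bochner_Integration.integrable_bound[OF sq_integrable_cmod_mult(1)[OF assms]])
      (auto simp: norm_mult)
qed

lemma norm_integral_mult_le:
  assumes "g \<in> sq_integrable M" "h \<in> sq_integrable M"
  shows "cmod (LINT x|M. g x * h x) \<le> l2norm M g * l2norm M h"
proof -
  have "cmod (LINT x|M. g x * h x) \<le> (LINT x|M. cmod (g x * h x))"
    by (rule integral_norm_bound)
  also have "\<dots> \<le> l2norm M g * l2norm M h"
    using sq_integrable_cmod_mult(2)[OF assms] by (simp add: norm_mult)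
  finally show ?thesis .
qed

lemma sq_integrable_cnj: "h \<in> sq_integrable M \<Longrightarrow> (\<lambda>x. cnj (h x)) \<in> sq_integrable M"
  unfolding sq_integrable_def by (auto intro!: borel_measurable_continuous_on[where f=cnj] continuous_intros)

lemma l2norm_cnj [simp]: "l2norm M (\<lambda>x. cnj (h x)) = l2norm M h"
  by (simp add: l2norm_def)

lemma l2inner_bound:
  assumes "g \<in> sq_integrable M" "h \<in> sq_integrable M"
  shows "cmod (l2inner M g h) \<le> l2norm M g * l2norm M h"
  using norm_integral_mult_le[OF assms(1) sq_integrable_cnj[OF assms(2)]] by (simp add: l2inner_def)

lemma l2inner_self: "l2inner M h h = of_real ((l2norm M h)\<^sup>2)"
  unfolding l2inner_def l2norm_power2 by (simp add: complex_norm_square[symmetric] flip: of_real_power)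

lemma l2inner_cnj: "l2inner M g h = cnj (l2inner M h g)"
  unfolding l2inner_def by (subst Bochner_Integration.integral_cnj[symmetric]) (simp add: mult.commute)

lemma l2inner_diff_left:
  assumes "g \<in> sq_integrable M" "g' \<in> sq_integrable M" "h \<in> sq_integrable M"
  shows "l2inner M (\<lambda>x. g x - g' x) h = l2inner M g h - l2inner M g' h"
  unfolding l2inner_def
  using integrable_mult_sq_integrable[OF assms(1) sq_integrable_cnj[OF assms(3)]]
    integrable_mult_sq_integrable[OF assms(2) sq_integrable_cnj[OF assms(3)]]
  by (simp add: left_diff_distrib)

lemma l2inner_scale_left: "l2inner M (\<lambda>x. c * g x) h = c * l2inner M g h"
  by (simp add: l2inner_def mult.assoc)

lemma l2inner_diff_right:
  assumes "g \<in> sq_integrable M" "h \<in> sq_integrable M" "h' \<in> sq_integrable M"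
  shows "l2inner M g (\<lambda>x. h x - h' x) = l2inner M g h - l2inner M g h'"
  using l2inner_diff_left[OF assms(2,3,1)] by (metis l2inner_cnj complex_cnj_diff)

lemma l2inner_scale_right: "l2inner M g (\<lambda>x. c * h x) = cnj c * l2inner M g h"
  by (metis l2inner_scale_left l2inner_cnj complex_cnj_mult)

lemma l2norm_scale: "l2norm M (\<lambda>x. c * h x) = cmod c * l2norm M h"
  by (simp add: l2norm_def norm_mult power_mult_distrib real_sqrt_mult)

lemma l2norm_diff_power2:
  assumes "g \<in> sq_integrable M" "h \<in> sq_integrable M"
  shows "(l2norm M (\<lambda>x. g x - h x))\<^sup>2 = (l2norm M g)\<^sup>2 - 2 * Re (l2inner M g h) + (l2norm M h)\<^sup>2"
proof -
  have d: "(\<lambda>x. g x - h x) \<in> sq_integrable M" by (rule sq_integrable_diff[OF assms])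
  have "complex_of_real ((l2norm M (\<lambda>x. g x - h x))\<^sup>2) =
      l2inner M g g - l2inner M g h - (l2inner M h g - l2inner M h h)"
    unfolding l2inner_self[symmetric] l2inner_diff_left[OF assms d]
      l2inner_diff_right[OF assms(1) assms] l2inner_diff_right[OF assms(2) assms] ..
  also have "l2inner M h g = cnj (l2inner M g h)" by (rule l2inner_cnj)
  finally have "Re (complex_of_real ((l2norm M (\<lambda>x. g x - h x))\<^sup>2)) =
      Re (l2inner M g g - l2inner M g h - (cnj (l2inner M g h) - l2inner M h h))" by simp
  then show ?thesis by (simp add: l2inner_self)
qed

lemma l2norm_triangle_diff:
  assumes "g \<in> sq_integrable M" "h \<in> sq_integrable M"
  shows "l2norm M (\<lambda>x. g x - h x) \<le> l2norm M g + l2norm M h"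
proof -
  have "- Re (l2inner M g h) \<le> l2norm M g * l2norm M h"
    using l2inner_bound[OF assms] abs_Re_le_cmod[of "l2inner M g h"] by linarith
  then have "(l2norm M (\<lambda>x. g x - h x))\<^sup>2 \<le> (l2norm M g + l2norm M h)\<^sup>2"
    unfolding l2norm_diff_power2[OF assms] by (simp add: power2_sum)
  then show ?thesis by (rule power2_le_imp_le) simp
qed

lemma l2norm_triangle:
  assumes "g \<in> sq_integrable M" "h \<in> sq_integrable M"
  shows "l2norm M (\<lambda>x. g x + h x) \<le> l2norm M g + l2norm M h"
  using l2norm_triangle_diff[OF assms(1) sq_integrable_scale[OF assms(2), of "-1"]]
  by (simp add: l2norm_scale[of M "-1" h, simplified] l2norm_def)

lemma l2norm_minus_commute: "l2norm M (\<lambda>x. g x - h x) = l2norm M (\<lambda>x. h x - g x)"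
  by (simp add: l2norm_def norm_minus_commute)

lemma l2norm_diff_triangle:
  assumes "g \<in> sq_integrable M" "h \<in> sq_integrable M" "k \<in> sq_integrable M"
  shows "l2norm M (\<lambda>x. g x - k x) \<le> l2norm M (\<lambda>x. g x - h x) + l2norm M (\<lambda>x. h x - k x)"
  using l2norm_triangle[OF sq_integrable_diff[OF assms(1,2)] sq_integrable_diff[OF assms(2,3)]] by simp

lemma l2norm_eq_0_iff:
  assumes "h \<in> sq_integrable M"
  shows "l2norm M h = 0 \<longleftrightarrow> (AE x in M. h x = 0)"
  using integral_nonneg_eq_0_iff_AE[OF sq_integrableD(2)[OF assms]] by (simp add: l2norm_def)

text \<open>Lower semicontinuity of the norm under almost everywhere convergence. The bounds
  \<open>C n\<close> may vary with \<open>n\<close>, so that only their limit enters the estimate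
  and sharp constants survive.\<close>

lemma sq_integrable_Fatou:
  assumes u: "\<And>n. u n \<in> sq_integrable M" and h: "h \<in> borel_measurable M"
    and lim: "AE x in M. (\<lambda>n. u n x) \<longlonglongrightarrow> h x"
    and C: "\<And>n. l2norm M (u n) \<le> C n" "C \<longlonglongrightarrow> D"
  shows "h \<in> sq_integrable M" "l2norm M h \<le> D"
proof -
  note [measurable] = sq_integrableD(1)[OF u] h
  have D0: "0 \<le> D"
    by (rule LIMSEQ_le_const[OF C(2)]) (meson C(1) l2norm_nonneg order_trans)
  have "(\<integral>\<^sup>+x. ennreal ((cmod (h x))\<^sup>2) \<partial>M) = (\<integral>\<^sup>+x. liminf (\<lambda>n. ennreal ((cmod (u n x))\<^sup>2)) \<partial>M)"
  proof (rule nn_integral_cong_AE)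
    show "AE x in M. ennreal ((cmod (h x))\<^sup>2) = liminf (\<lambda>n. ennreal ((cmod (u n x))\<^sup>2))"
      using lim
    proof eventually_elim
      case (elim x)
      then have "(\<lambda>n. ennreal ((cmod (u n x))\<^sup>2)) \<longlonglongrightarrow> ennreal ((cmod (h x))\<^sup>2)"
        by (intro tendsto_intros)
      then show ?case by (intro lim_imp_Liminf[symmetric]) simp
    qed
  qed
  also have "\<dots> \<le> liminf (\<lambda>n. \<integral>\<^sup>+x. ennreal ((cmod (u n x))\<^sup>2) \<partial>M)"
    by (rule nn_integral_liminf) measurable
  also have "\<dots> \<le> liminf (\<lambda>n. ennreal ((C n)\<^sup>2))"
    by (intro Liminf_mono always_eventually allI)
      (auto simp: nn_integral_l2norm[OF u] intro!: ennreal_leI power_mono C)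
  also have "\<dots> = ennreal (D\<^sup>2)"
    by (intro lim_imp_Liminf tendsto_intros C) simp
  finally have "(\<integral>\<^sup>+x. ennreal ((cmod (h x))\<^sup>2) \<partial>M) \<le> ennreal (D\<^sup>2)" .
  from sq_integrable_nnI[OF h this D0] show "h \<in> sq_integrable M" "l2norm M h \<le> D" by auto
qed

text \<open>Riesz--Fischer for a fast Cauchy sequence: the weighted sum of the squares
  \<open>\<Sum>n. 2 ^ n * |a (n + 1) - a n|\<^sup>2\<close> is integrable, hence finite almost everywhere, and this bounds
  the increments pointwise by a geometric sequence.\<close>

lemma sq_integrable_complete:
  assumes a: "\<And>n. a n \<in> sq_integrable M"
    and fast: "\<And>n. l2norm M (\<lambda>x. a (Suc n) x - a n x) \<le> K * (1/2) ^ n"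
  obtains h where "h \<in> sq_integrable M" "(\<lambda>n. l2norm M (\<lambda>x. h x - a n x)) \<longlonglongrightarrow> 0"
proof -
  note [measurable] = sq_integrableD(1)[OF a]
  have K0: "0 \<le> K" using order_trans[OF l2norm_nonneg fast[of 0]] by simp
  define d where "d n x = a (Suc n) x - a n x" for n x
  have d: "d n \<in> sq_integrable M" for n unfolding d_def by (rule sq_integrable_diff; rule a)
  note [measurable] = sq_integrableD(1)[OF d]
  have "(\<integral>\<^sup>+x. (\<Sum>n. ennreal (2 ^ n * (cmod (d n x))\<^sup>2)) \<partial>M)
      = (\<Sum>n. \<integral>\<^sup>+x. ennreal (2 ^ n * (cmod (d n x))\<^sup>2) \<partial>M)"
    by (rule nn_integral_suminf) measurable
  also have "\<dots> = (\<Sum>n. ennreal (2 ^ n * (l2norm M (d n))\<^sup>2))"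
    by (simp add: ennreal_mult nn_integral_cmult nn_integral_l2norm[OF d])
  also have "\<dots> \<le> (\<Sum>n. ennreal (K\<^sup>2 * (1/2) ^ n))"
  proof (intro suminf_le ennreal_leI)
    fix n
    have "(l2norm M (d n))\<^sup>2 \<le> (K * (1/2) ^ n)\<^sup>2"
      unfolding d_def by (intro power_mono fast) simp
    then have "2 ^ n * (l2norm M (d n))\<^sup>2 \<le> 2 ^ n * (K * (1/2) ^ n)\<^sup>2" by simp
    also have "\<dots> = K\<^sup>2 * (1/2) ^ n"
      by (simp add: power2_eq_square field_simps flip: power_add)
    finally show "2 ^ n * (l2norm M (d n))\<^sup>2 \<le> K\<^sup>2 * (1/2) ^ n" .
  qed auto
  also have "\<dots> = ennreal (\<Sum>n. K\<^sup>2 * (1/2) ^ n)"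
    by (rule suminf_ennreal2) (auto intro!: summable_mult summable_geometric)
  also have "\<dots> < \<infinity>" by simp
  finally have fin: "(\<integral>\<^sup>+x. (\<Sum>n. ennreal (2 ^ n * (cmod (d n x))\<^sup>2)) \<partial>M) < \<infinity>" .
  have "AE x in M. (\<Sum>n. ennreal (2 ^ n * (cmod (d n x))\<^sup>2)) \<noteq> \<infinity>"
    by (rule nn_integral_noteq_infinite) (use fin in auto)
  then have conv: "AE x in M. convergent (\<lambda>n. a n x)"
  proof eventually_elim
    case (elim x)
    have sm: "summable (\<lambda>n. 2 ^ n * (cmod (d n x))\<^sup>2)"
      by (rule summable_suminf_not_top) (use elim in auto)
    then have "(\<lambda>n. 2 ^ n * (cmod (d n x))\<^sup>2) \<longlonglongrightarrow> 0" by (rule summable_LIMSEQ_zero)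
    then have "Bseq (\<lambda>n. 2 ^ n * (cmod (d n x))\<^sup>2)"
      using convergent_imp_Bseq convergentI by blast
    then obtain B where B: "B > 0" "\<And>n. 2 ^ n * (cmod (d n x))\<^sup>2 \<le> B"
      by (auto simp: Bseq_def abs_mult)
    have "summable (\<lambda>n. sqrt B * (sqrt (1/2)) ^ n)"
      by (intro summable_mult summable_geometric) (simp add: real_sqrt_divide)
    then have "summable (\<lambda>n. d n x)"
    proof (rule summable_comparison_test_ev[rotated])
      show "\<forall>\<^sub>F n in sequentially. norm (d n x) \<le> sqrt B * (sqrt (1/2)) ^ n"
      proof (intro always_eventually allI)
        fix n
        have "(cmod (d n x))\<^sup>2 \<le> B * (1/2) ^ n"
          using B(2)[of n] by (simp add: field_simps)
        then have "cmod (d n x) \<le> sqrt (B * (1/2) ^ n)" by (rule real_le_rsqrt)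
        then show "norm (d n x) \<le> sqrt B * (sqrt (1/2)) ^ n"
          by (simp add: real_sqrt_mult real_sqrt_power)
      qed
    qed
    then have "convergent (\<lambda>n. \<Sum>i<n. d i x)" by (simp add: summable_iff_convergent)
    moreover have "(\<Sum>i<n. d i x) = a n x - a 0 x" for n
      unfolding d_def by (rule sum_lessThan_telescope)
    ultimately have "convergent (\<lambda>n. a n x - a 0 x)" by simp
    then show ?case by (metis convergent_diff_const_right_iff)
  qed
  define h where "h x = lim (\<lambda>n. a n x)" for x
  have h[measurable]: "h \<in> borel_measurable M" unfolding h_def by measurable
  have lim: "AE x in M. (\<lambda>n. a n x) \<longlonglongrightarrow> h x"
    using conv by eventually_elim (simp add: h_def convergent_LIMSEQ_iff)
  \<comment> \<open>The factor \<open>1 - (1/2) ^ m\<close> is that of the finite geometric sum;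
    with it the induction on \<open>m\<close> closes exactly.\<close>
  have tail: "l2norm M (\<lambda>x. a (n + m) x - a n x) \<le> 2 * K * (1/2) ^ n * (1 - (1/2) ^ m)" for n m
  proof (induction m)
    case 0
    then show ?case by (simp add: l2norm_def)
  next
    case (Suc m)
    have "l2norm M (\<lambda>x. a (n + Suc m) x - a n x) \<le>
        l2norm M (\<lambda>x. a (n + Suc m) x - a (n + m) x) + l2norm M (\<lambda>x. a (n + m) x - a n x)"
      by (rule l2norm_diff_triangle; rule a)
    also have "\<dots> \<le> K * (1/2) ^ (n + m) + 2 * K * (1/2) ^ n * (1 - (1/2) ^ m)"
      using fast[of "n + m"] Suc by simp
    finally show ?case by (simp add: field_simps power_add)
  qed
  \<comment> \<open>So far \<open>h\<close> is only measurable. Fatou in \<open>m\<close>, with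
    \<open>n\<close> fixed, gives both that \<open>h\<close> differs from \<open>a n\<close> by a
    square-integrable function and the rate of convergence.\<close>
  have diff: "(\<lambda>x. h x - a n x) \<in> sq_integrable M \<and> l2norm M (\<lambda>x. h x - a n x) \<le> 2 * K * (1/2) ^ n" for n
  proof -
    have 1: "(\<lambda>x. a (n + m) x - a n x) \<in> sq_integrable M" for m by (rule sq_integrable_diff; rule a)
    have 2: "l2norm M (\<lambda>x. a (n + m) x - a n x) \<le> 2 * K * (1/2) ^ n" for m
      using K0 by (intro order_trans[OF tail] mult_left_le) auto
    have 3: "AE x in M. (\<lambda>m. a (n + m) x - a n x) \<longlonglongrightarrow> h x - a n x"
      using lim by eventually_elim
        (intro tendsto_intros, subst add.commute, erule LIMSEQ_ignore_initial_segment)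
    from sq_integrable_Fatou[where u="\<lambda>m x. a (n + m) x - a n x", OF 1 _ 3 2 tendsto_const]
    show ?thesis by simp
  qed
  have "(\<lambda>x. (h x - a 0 x) + a 0 x) \<in> sq_integrable M"
    using diff a by (intro sq_integrable_add) auto
  then have "h \<in> sq_integrable M" by simp
  moreover have "(\<lambda>n. l2norm M (\<lambda>x. h x - a n x)) \<longlonglongrightarrow> 0"
  proof (rule tendsto_sandwich[of "\<lambda>_. 0" _ _ "\<lambda>n. 2 * K * (1/2) ^ n"])
    have "(\<lambda>n. 2 * K * (1/2::real) ^ n) \<longlonglongrightarrow> 2 * K * 0"
      by (intro tendsto_intros LIMSEQ_power_zero) simp
    then show "(\<lambda>n. 2 * K * (1/2::real) ^ n) \<longlonglongrightarrow> 0" by simp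
  qed (use diff in auto)
  ultimately show thesis by (rule that)
qed

section \<open>Haar measure of a unimodular group\<close>

lemma continuous_on_diff_group [continuous_intros]:
  fixes f g :: "'b::topological_space \<Rightarrow> 'a::topological_group_add"
  assumes "continuous_on s f" "continuous_on s g"
  shows "continuous_on s (\<lambda>x. f x - g x)"
  unfolding diff_conv_add_uminus by (intro continuous_intros assms)

lemma compact_minus_group:
  fixes K :: "'a::topological_group_add set"
  shows "compact K \<Longrightarrow> compact (uminus ` K)"
  by (intro compact_continuous_image continuous_intros)

lemma open_uminus_image:
  fixes U :: "'a::topological_group_add set"
  assumes "open U" shows "open (uminus ` U)"
proof -
  have "uminus ` U = uminus -` U" by (auto simp: image_iff intro!: bexI[of _ "- _"])
  moreover have "open (uminus -` U)" using assms by (rule open_vimage) (intro continuous_intros)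
  ultimately show ?thesis by simp
qed

lemma compact_plus_group:
  fixes K L :: "'a::topological_group_add set"
  assumes "compact K" "compact L"
  shows "compact ((\<lambda>(x, y). x + y) ` (K \<times> L))"
  using assms by (auto intro!: compact_continuous_image compact_Times continuous_intros simp: case_prod_unfold)

lemma CcI:
  fixes f :: "'a::t2_space \<Rightarrow> complex"
  assumes "continuous_on UNIV f" "compact K" "\<And>x. f x \<noteq> 0 \<Longrightarrow> x \<in> K"
  shows "f \<in> Cc"
proof -
  have "closure {x. f x \<noteq> 0} \<subseteq> K"
    using assms by (intro closure_minimal compact_imp_closed) auto
  then have "compact (K \<inter> closure {x. f x \<noteq> 0})"
    using assms(2) by (intro compact_Int_closed) auto
  moreover have "K \<inter> closure {x. f x \<noteq> 0} = closure {x. f x \<noteq> 0}"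
    using \<open>closure {x. f x \<noteq> 0} \<subseteq> K\<close> by blast
  ultimately show ?thesis using assms(1) by (simp add: Cc_def)
qed

lemma Cc_continuous: "f \<in> Cc \<Longrightarrow> continuous_on UNIV f"
  by (simp add: Cc_def)

lemma CcE:
  assumes "f \<in> Cc"
  obtains K where "compact K" "{x. f x \<noteq> 0} \<subseteq> K"
  using assms closure_subset by (fastforce simp: Cc_def)

lemma Cc_continuous_compose:
  assumes "f \<in> Cc" "continuous_on S g"
  shows "continuous_on S (\<lambda>x. f (g x))"
  using Cc_continuous[OF assms(1)] assms(2) by (rule continuous_on_compose2) auto

lemma Cc_diff:
  fixes f g :: "'a::t2_space \<Rightarrow> complex"
  assumes "f \<in> Cc" "g \<in> Cc"
  shows "(\<lambda>x. f x - g x) \<in> Cc"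
proof -
  obtain K where "compact K" "{x. f x \<noteq> 0} \<subseteq> K" using assms(1) by (rule CcE)
  moreover obtain L where "compact L" "{x. g x \<noteq> 0} \<subseteq> L" using assms(2) by (rule CcE)
  ultimately show ?thesis
    by (intro CcI[where K="K \<union> L"] continuous_on_diff assms[THEN Cc_continuous] compact_Un) (auto, force)
qed

lemma Cc_scale:
  fixes f :: "'a::t2_space \<Rightarrow> complex"
  assumes "f \<in> Cc" shows "(\<lambda>x. c * f x) \<in> Cc"
proof -
  obtain K where "compact K" "{x. f x \<noteq> 0} \<subseteq> K"
    using assms by (rule CcE)
  then show ?thesis
    by (intro CcI[where K=K] continuous_on_mult assms[THEN Cc_continuous] continuous_on_const) auto
qed

lemma Cc_add:
  fixes f g :: "'a::t2_space \<Rightarrow> complex"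
  assumes "f \<in> Cc" "g \<in> Cc"
  shows "(\<lambda>x. f x + g x) \<in> Cc"
  using Cc_diff[OF assms(1) Cc_scale[OF assms(2), of "-1"]] by simp

lemma Cc_bounded:
  assumes "f \<in> Cc" obtains B where "0 \<le> B" "\<forall>x. cmod (f x) \<le> B"
proof -
  obtain K where K: "compact K" "{x. f x \<noteq> 0} \<subseteq> K" using assms by (rule CcE)
  have "bounded (f ` K)"
    by (intro compact_imp_bounded compact_continuous_image K continuous_on_subset[OF Cc_continuous[OF assms]]) auto
  then obtain B where B: "\<And>y. y \<in> f ` K \<Longrightarrow> cmod y \<le> B" by (auto simp: bounded_iff)
  show thesis
  proof (rule that[of "max B 0"])
    show "\<forall>x. cmod (f x) \<le> max B 0"
    proof
      fix x
      show "cmod (f x) \<le> max B 0"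
        using B[of "f x"] K(2) by (cases "f x = 0") (auto simp: le_max_iff_disj)
    qed
  qed simp
qed

text \<open>Locally compact Hausdorff spaces are completely regular. Separating \<open>K\<close>
  from the complement of \<open>U \<inter> V\<close>, where the open set \<open>V\<close> lies in a
  compact set \<open>L\<close>, also confines the support to \<open>L\<close>.\<close>

lemma Urysohn_locally_compact:
  fixes K U :: "'a::t2_space set"
  assumes lc: "locally_compact_space (euclidean :: 'a topology)"
    and K: "compact K" and U: "open U" "K \<subseteq> U"
  obtains g :: "'a \<Rightarrow> real" where "(\<lambda>x. of_real (g x)) \<in> Cc" "\<And>x. 0 \<le> g x" "\<And>x. g x \<le> 1"
    "\<And>x. x \<in> K \<Longrightarrow> g x = 1" "\<And>x. x \<notin> U \<Longrightarrow> g x = 0"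
proof -
  have H: "Hausdorff_space (euclidean :: 'a topology)"
    unfolding Hausdorff_space_def by (auto simp: disjnt_def dest!: hausdorff)
  have "completely_regular_space (euclidean :: 'a topology)"
    using lc H by (meson locally_compact_regular_imp_completely_regular_space)
  moreover obtain V L where V: "open V" "compact L" "K \<subseteq> V" "V \<subseteq> L"
    using lc K unfolding locally_compact_space_compact_closed_compact[OF disjI1[OF H]]
    by (auto simp flip: open_openin)
  ultimately obtain g where g: "continuous_map euclidean (top_of_set {0..1::real}) g"
      "g ` (- (U \<inter> V)) \<subseteq> {0}" "g ` K \<subseteq> {1}"
    using Urysohn_completely_regular_compact_closed[of 0 1 "euclidean :: 'a topology" K "- (U \<inter> V)"] U V K
    by (auto simp: disjnt_def)
  show thesis
  proof
    show "(\<lambda>x. complex_of_real (g x)) \<in> Cc"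
    proof (rule CcI)
      show "continuous_on UNIV (\<lambda>x. complex_of_real (g x))"
        using g(1) by (intro continuous_intros) (simp add: continuous_map_in_subtopology)
      show "compact L" by fact
      show "complex_of_real (g x) \<noteq> 0 \<Longrightarrow> x \<in> L" for x using g(2) V by (cases "x \<in> V") auto
    qed
    show "0 \<le> g x" "g x \<le> 1" for x using g(1) by (auto simp: continuous_map_in_subtopology)
  qed (use g in auto)
qed

text \<open>Each point is assigned to the first member of an enumerated cover that contains it. This
  yields the step functions used for interchanging integrals.\<close>

lemma finite_cover_disjoint:
  fixes K :: "'a set"
  assumes "finite T" "K \<subseteq> (\<Union>t\<in>T. X t)"
  obtains n :: nat and t E where "\<And>i. i < n \<Longrightarrow> t i \<in> T"
    "\<And>i. i < n \<Longrightarrow> E i = (K \<inter> X (t i)) - (\<Union>j<i. X (t j))"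
    "\<And>x. x \<in> K \<Longrightarrow> \<exists>!i. i < n \<and> x \<in> E i"
proof -
  obtain t where t: "bij_betw t {0..<card T} T" using ex_bij_betw_nat_finite[OF assms(1)] by blast
  define E where "E i = (K \<inter> X (t i)) - (\<Union>j<i. X (t j))" for i
  show thesis
  proof (rule that[of "card T" t E])
    show "t i \<in> T" if "i < card T" for i using that t by (auto simp: bij_betw_def)
    show "E i = (K \<inter> X (t i)) - (\<Union>j<i. X (t j))" for i by (simp add: E_def)
    fix x assume x: "x \<in> K"
    then obtain u where u: "u \<in> T" "x \<in> X u" using assms(2) by blast
    moreover from u obtain i where "i < card T" "u = t i"
      using t unfolding bij_betw_def by (metis atLeastLessThan_iff imageE)
    ultimately have i: "i < card T" "x \<in> X (t i)" by auto
    define m where "m = (LEAST j. x \<in> X (t j))"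
    have m: "x \<in> X (t m)" "m \<le> i" "\<And>j. j < m \<Longrightarrow> x \<notin> X (t j)"
      unfolding m_def using i(2) by (auto intro: LeastI Least_le dest: not_less_Least)
    show "\<exists>!i. i < card T \<and> x \<in> E i"
    proof (rule ex1I[of _ m])
      show "m < card T \<and> x \<in> E m" using m i x by (auto simp: E_def)
      show "j = m" if "j < card T \<and> x \<in> E j" for j
        using that m unfolding E_def by (metis DiffE IntD2 UN_I lessThan_iff linorder_neqE_nat)
    qed
  qed
qed

text \<open>Right invariance of the one measure at hand stands in for \<open>unimodular\<close>,
  which quantifies over all left Haar measures.\<close>

locale unimodular_haar =
  fixes \<mu> :: "'a::{topological_group_add,t2_space} measure"
  assumes locally_compact: "locally_compact_space (euclidean :: 'a topology)"
    and haar: "left_haar_measure \<mu>"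
    and right_invariant: "right_invariant \<mu>"
begin

section \<open>Integrability on compact sets and invariance under translations\<close>

lemma radon: "radon_measure \<mu>"
  using haar by (simp add: left_haar_measure_def)

lemma sets_haar [measurable_cong, simp]: "sets \<mu> = sets borel"
  using radon by (simp add: radon_measure_def)

lemma space_haar [simp]: "space \<mu> = UNIV"
  using sets_eq_imp_space_eq[OF sets_haar] by simp

lemma borel_measurable_haar: "borel_measurable \<mu> = borel_measurable borel"
  by (rule measurable_cong_sets) simp_all

lemma continuous_measurable: "continuous_on UNIV f \<Longrightarrow> f \<in> borel_measurable \<mu>"
  unfolding borel_measurable_haar by (rule borel_measurable_continuous_onI)

lemma compact_sets: "compact K \<Longrightarrow> K \<in> sets \<mu>"
  by (simp add: borel_compact)

lemma emeasure_compact_finite: "compact K \<Longrightarrow> emeasure \<mu> K < \<infinity>"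
  using radon by (simp add: radon_measure_def)

lemma outer_regular: "A \<in> sets borel \<Longrightarrow> emeasure \<mu> A = (INF U\<in>{U. open U \<and> A \<subseteq> U}. emeasure \<mu> U)"
  using radon unfolding radon_measure_def by blast

lemma inner_regular: "open U \<Longrightarrow> emeasure \<mu> U = (SUP K\<in>{K. compact K \<and> K \<subseteq> U}. emeasure \<mu> K)"
  using radon unfolding radon_measure_def by blast

lemma Cc_measurable: "f \<in> Cc \<Longrightarrow> f \<in> borel_measurable \<mu>"
  by (rule continuous_measurable[OF Cc_continuous])

lemma integrable_indicator_compact:
  "compact K \<Longrightarrow> integrable \<mu> (indicator K :: 'a \<Rightarrow> real)"
  by (intro integrable_real_indicator emeasure_compact_finite compact_sets)

lemma integrable_compact_support:
  fixes f :: "'a \<Rightarrow> 'b::{banach,second_countable_topology}"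
  assumes "f \<in> borel_measurable \<mu>" "compact K" "\<And>x. x \<notin> K \<Longrightarrow> f x = 0" "\<And>x. norm (f x) \<le> B"
  shows "integrable \<mu> f"
proof (rule Bochner_Integration.integrable_bound[of _ "\<lambda>x. B * indicator K x"])
  show "integrable \<mu> (\<lambda>x. B * indicator K x :: real)"
    using assms(2) by (auto intro!: integrable_real_indicator emeasure_compact_finite compact_sets)
  show "AE x in \<mu>. norm (f x) \<le> norm (B * indicator K x :: real)"
  proof (rule AE_I2)
    fix x
    show "norm (f x) \<le> norm (B * indicator K x :: real)"
      using assms(3)[of x] assms(4)[of x] by (auto simp: indicator_def)
  qed
qed fact

lemma Cc_integrable:
  assumes "f \<in> Cc" shows "integrable \<mu> f"
proof -
  obtain K where K: "compact K" "{x. f x \<noteq> 0} \<subseteq> K" using assms by (rule CcE)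
  obtain B where B: "\<forall>x. cmod (f x) \<le> B" using assms by (rule Cc_bounded)
  show ?thesis
    by (rule integrable_compact_support[OF Cc_measurable[OF assms] K(1)]) (use K B in auto)
qed

lemma Cc_sq_integrable:
  assumes "f \<in> Cc" shows "f \<in> sq_integrable \<mu>"
proof -
  obtain K where K: "compact K" "{x. f x \<noteq> 0} \<subseteq> K" using assms by (rule CcE)
  obtain B where B: "\<forall>x. cmod (f x) \<le> B" using assms by (rule Cc_bounded)
  note [measurable] = Cc_measurable[OF assms]
  have "integrable \<mu> (\<lambda>x. (cmod (f x))\<^sup>2)"
    by (rule integrable_compact_support[OF _ K(1), where B="B\<^sup>2"])
      (use K B in \<open>auto intro!: power_mono\<close>)
  then show ?thesis by (simp add: sq_integrable_def)
qed

lemma measurable_left [measurable]: "(\<lambda>y. x + y) \<in> measurable \<mu> \<mu>"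
  using borel_measurable_continuous_onI[of "\<lambda>y. x + y"]
  by (simp add: measurable_cong_sets[OF sets_haar sets_haar] continuous_intros)

lemma measurable_right [measurable]: "(\<lambda>y. y + x) \<in> measurable \<mu> \<mu>"
  using borel_measurable_continuous_onI[of "\<lambda>y. y + x"]
  by (simp add: measurable_cong_sets[OF sets_haar sets_haar] continuous_intros)

lemma measurable_uminus_haar [measurable]: "uminus \<in> measurable \<mu> \<mu>"
  using borel_measurable_continuous_onI[of "uminus :: 'a \<Rightarrow> 'a"]
  by (simp add: measurable_cong_sets[OF sets_haar sets_haar] continuous_intros)

lemma distr_left: "distr \<mu> \<mu> (\<lambda>y. x + y) = \<mu>"
proof (rule measure_eqI)
  fix A assume "A \<in> sets (distr \<mu> \<mu> (\<lambda>y. x + y))"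
  then have A: "A \<in> sets borel" by simp
  have "(\<lambda>y. x + y) -` A = (\<lambda>y. - x + y) ` A"
    by (auto simp: image_iff add.assoc[symmetric] intro!: bexI[of _ "x + _"])
  moreover have "emeasure \<mu> ((\<lambda>y. - x + y) ` A) = emeasure \<mu> A"
    using haar A by (auto simp: left_haar_measure_def left_invariant_def)
  ultimately show "emeasure (distr \<mu> \<mu> (\<lambda>y. x + y)) A = emeasure \<mu> A"
    using A by (simp add: emeasure_distr measurable_left measurable_right)
qed simp

lemma distr_right: "distr \<mu> \<mu> (\<lambda>y. y + x) = \<mu>"
proof (rule measure_eqI)
  fix A assume "A \<in> sets (distr \<mu> \<mu> (\<lambda>y. y + x))"
  then have A: "A \<in> sets borel" by simp
  have "(\<lambda>y. y + x) -` A = (\<lambda>y. y + - x) ` A"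
    by (auto simp: image_iff add.assoc intro!: bexI[of _ "_ + x"])
  moreover have "emeasure \<mu> ((\<lambda>y. y + - x) ` A) = emeasure \<mu> A"
    using right_invariant A unfolding right_invariant_def by blast
  ultimately show "emeasure (distr \<mu> \<mu> (\<lambda>y. y + x)) A = emeasure \<mu> A"
    using A by (simp add: emeasure_distr measurable_left measurable_right)
qed simp

lemma integral_left:
  fixes f :: "'a \<Rightarrow> 'b::{banach,second_countable_topology}"
  assumes "f \<in> borel_measurable \<mu>"
  shows "(LINT y|\<mu>. f (x + y)) = (LINT y|\<mu>. f y)"
  using integral_distr[OF measurable_left[of x] assms] by (simp add: distr_left)

lemma integral_right:
  fixes f :: "'a \<Rightarrow> 'b::{banach,second_countable_topology}"
  assumes "f \<in> borel_measurable \<mu>"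
  shows "(LINT y|\<mu>. f (y + x)) = (LINT y|\<mu>. f y)"
  using integral_distr[OF measurable_right[of x] assms] by (simp add: distr_right)

section \<open>Parameter integrals and interchange of integration\<close>

lemma norm_integral_diff_le:
  fixes u v :: "'a \<Rightarrow> 'b::{banach,second_countable_topology}"
  assumes "integrable \<mu> u" "integrable \<mu> v" "compact K"
    "\<And>x. x \<in> K \<Longrightarrow> norm (u x - v x) \<le> c" "\<And>x. x \<notin> K \<Longrightarrow> u x = v x"
  shows "norm ((LINT x|\<mu>. u x) - (LINT x|\<mu>. v x)) \<le> c * measure \<mu> K"
proof -
  have "norm ((LINT x|\<mu>. u x) - (LINT x|\<mu>. v x)) = norm (LINT x|\<mu>. u x - v x)"
    using assms by simp
  also have "\<dots> \<le> (LINT x|\<mu>. norm (u x - v x))" by (rule integral_norm_bound)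
  also have "\<dots> \<le> (LINT x|\<mu>. c * indicator K x)"
  proof (rule integral_mono)
    show "integrable \<mu> (\<lambda>x. norm (u x - v x))" using assms by simp
    show "integrable \<mu> (\<lambda>x. c * indicator K x)"
      using integrable_indicator_compact[OF assms(3)] by simp
    show "norm (u x - v x) \<le> c * indicator K x" for x
      using assms(4,5)[of x] by (auto simp: indicator_def)
  qed
  also have "\<dots> = c * measure \<mu> K" by simp
  finally show ?thesis .
qed

text \<open>The product topology need not be second countable, so a continuous function of two variables
  is not visibly measurable for the product sigma-algebra; it is compared with sums of products instead.\<close>

lemma integral_param_tube:
  fixes F :: "'c::topological_space \<Rightarrow> 'a \<Rightarrow> complex"
  assumes F: "continuous_on UNIV (\<lambda>(x, y). F x y)" and L: "compact L"
    and supp: "\<And>x y. F x y \<noteq> 0 \<Longrightarrow> y \<in> L" and e: "e > 0"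
  obtains X where "x \<in> X" "open X" "\<forall>x'\<in>X. \<forall>y. cmod (F x' y - F x y) \<le> e"
proof -
  have "continuous_on (UNIV \<times> L) (\<lambda>(x, y). F x y)"
    using F by (rule continuous_on_subset) auto
  from continuous_on_prod_compactE[OF this L UNIV_I[of x] e]
  obtain X where X: "x \<in> X" "open X" "\<forall>x'\<in>X. \<forall>y\<in>L. dist (F x' y) (F x y) \<le> e" by auto
  show thesis
  proof (rule that[OF X(1,2)])
    have "cmod (F x' y - F x y) \<le> e" if "x' \<in> X" for x' y
    proof (cases "y \<in> L")
      case False
      then have "F x' y = 0" "F x y = 0" using supp by blast+
      then show ?thesis using e by simp
    qed (use X(3) that in \<open>auto simp: dist_norm\<close>)
    then show "\<forall>x'\<in>X. \<forall>y. cmod (F x' y - F x y) \<le> e" by blast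
  qed
qed

lemma Cc_section:
  fixes F :: "'c::topological_space \<Rightarrow> 'a \<Rightarrow> complex"
  assumes F: "continuous_on UNIV (\<lambda>(x, y). F x y)" and L: "compact L"
    and supp: "\<And>y. F x y \<noteq> 0 \<Longrightarrow> y \<in> L"
  shows "F x \<in> Cc"
proof (rule CcI[OF _ L])
  have "continuous_on UNIV ((\<lambda>(x, y). F x y) \<circ> (\<lambda>y. (x, y)))"
    by (intro continuous_on_compose continuous_intros continuous_on_subset[OF F]) auto
  then show "continuous_on UNIV (F x)" by (simp add: o_def)
qed (use supp in auto)

lemma continuous_integral_param:
  fixes F :: "'c::topological_space \<Rightarrow> 'a \<Rightarrow> complex"
  assumes F: "continuous_on UNIV (\<lambda>(x, y). F x y)" and L: "compact L"
    and supp: "\<And>x y. F x y \<noteq> 0 \<Longrightarrow> y \<in> L"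
  shows "continuous_on UNIV (\<lambda>x. LINT y|\<mu>. F x y)"
  unfolding continuous_on_def
proof
  fix x
  have int: "integrable \<mu> (F x)" for x
    by (rule Cc_integrable[OF Cc_section[OF F L supp]])
  have "((\<lambda>x. LINT y|\<mu>. F x y) \<longlongrightarrow> (LINT y|\<mu>. F x y)) (nhds x)"
  proof (rule tendstoI)
    fix e :: real assume e: "e > 0"
    \<comment> \<open>Adding 1 keeps the divisor positive when \<open>L\<close> is a null
      set.\<close>
    define m where "m = measure \<mu> L + 1"
    have m: "m > 0" by (simp add: m_def add_nonneg_pos)
    define d where "d = e / (2 * m)"
    have d: "d > 0" using e m by (simp add: d_def)
    obtain X where X: "x \<in> X" "open X" "\<forall>x'\<in>X. \<forall>y. cmod (F x' y - F x y) \<le> d"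
      by (rule integral_param_tube[OF F L supp d])
    have "dist (LINT y|\<mu>. F x' y) (LINT y|\<mu>. F x y) < e" if "x' \<in> X" for x'
    proof -
      have "cmod ((LINT y|\<mu>. F x' y) - (LINT y|\<mu>. F x y)) \<le> d * measure \<mu> L"
        using X(3) that supp by (intro norm_integral_diff_le int L) (auto, metis)
      also have "\<dots> \<le> d * m" using d by (simp add: m_def)
      also have "\<dots> = e / 2" using m by (simp add: d_def)
      also have "\<dots> < e" using e by simp
      finally show ?thesis by (simp add: dist_norm)
    qed
    then show "\<forall>\<^sub>F x' in nhds x. dist (LINT y|\<mu>. F x' y) (LINT y|\<mu>. F x y) < e"
      using X(1,2) by (auto simp: eventually_nhds)
  qed
  then show "((\<lambda>x. LINT y|\<mu>. F x y) \<longlongrightarrow> (LINT y|\<mu>. F x y)) (at x within UNIV)"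
    by (rule tendsto_mono[rotated]) (simp add: at_within_def)
qed

lemma Cc_integral_param:
  fixes F :: "'c::t2_space \<Rightarrow> 'a \<Rightarrow> complex"
  assumes F: "continuous_on UNIV (\<lambda>(x, y). F x y)" and "compact K" and L: "compact L"
    and supp: "\<And>x y. F x y \<noteq> 0 \<Longrightarrow> x \<in> K \<and> y \<in> L"
  shows "(\<lambda>x. LINT y|\<mu>. F x y) \<in> Cc"
proof (rule CcI[OF continuous_integral_param[OF F L] \<open>compact K\<close>])
  show "x \<in> K" if "(LINT y|\<mu>. F x y) \<noteq> 0" for x
  proof (rule ccontr)
    assume "x \<notin> K"
    then have "F x = (\<lambda>y. 0)" using supp by blast
    then show False using that by simp
  qed
qed (use supp in auto)

text \<open>On a finite Borel partition of \<open>K\<close> into pieces \<open>E i\<close>, replace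
  \<open>F x y\<close> by \<open>F (t i) y\<close> for \<open>x\<close> in \<open>E i\<close>. By
  the tube lemma the error is uniformly at most \<open>e\<close>, so either iterated integral
  changes by at most \<open>e\<close> times the measures of \<open>K\<close> and \<open>L\<close>.
  For the replacement \<open>G\<close>, a finite sum of products, the order of integration is
  immaterial.\<close>

lemma Fubini_Cc:
  fixes F :: "'a \<Rightarrow> 'a \<Rightarrow> complex"
  assumes F: "continuous_on UNIV (\<lambda>(x, y). F x y)" and K: "compact K" and L: "compact L"
    and supp: "\<And>x y. F x y \<noteq> 0 \<Longrightarrow> x \<in> K \<and> y \<in> L"
  shows "(LINT x|\<mu>. LINT y|\<mu>. F x y) = (LINT y|\<mu>. LINT x|\<mu>. F x y)" (is "?I = ?J")
proof -
  have F': "continuous_on UNIV (\<lambda>(y, x). F x y)"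
    using continuous_on_compose2[OF F, of UNIV "\<lambda>(y, x). (x, y)"]
    by (simp add: case_prod_unfold continuous_intros)
  have intx: "integrable \<mu> (\<lambda>y. F x y)" for x
    using supp by (intro Cc_integrable Cc_section[OF F L]) auto
  have inty: "integrable \<mu> (\<lambda>x. F x y)" for y
    using supp by (intro Cc_integrable Cc_section[OF F' K]) auto
  have int1: "integrable \<mu> (\<lambda>x. LINT y|\<mu>. F x y)"
    by (intro Cc_integrable Cc_integral_param[OF F K L] supp)
  have int2: "integrable \<mu> (\<lambda>y. LINT x|\<mu>. F x y)"
    by (intro Cc_integrable Cc_integral_param[OF F' L K]) (use supp in auto)
  have supp': "F x y \<noteq> 0 \<Longrightarrow> y \<in> L" for x y using supp by blast
  have close: "cmod (?I - ?J) \<le> e * (2 * measure \<mu> K * measure \<mu> L)" if e: "e > 0" for e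
  proof -
    have "\<forall>x. \<exists>X. x \<in> X \<and> open X \<and> (\<forall>x'\<in>X. \<forall>y. cmod (F x' y - F x y) \<le> e)"
    proof
      fix x
      show "\<exists>X. x \<in> X \<and> open X \<and> (\<forall>x'\<in>X. \<forall>y. cmod (F x' y - F x y) \<le> e)"
        by (rule integral_param_tube[OF F L supp' e]) blast+
    qed
    then obtain X where X: "\<And>x. x \<in> X x" "\<And>x. open (X x)"
        "\<And>x x' y. x' \<in> X x \<Longrightarrow> cmod (F x' y - F x y) \<le> e" by metis
    obtain T where T: "finite T" "K \<subseteq> (\<Union>t\<in>T. X t)"
      using compactE_image[OF K, of UNIV X] X by (metis UN_I UNIV_I subsetI)
    obtain n :: nat and t E where E: "\<And>i. i < n \<Longrightarrow> E i = (K \<inter> X (t i)) - (\<Union>j<i. X (t j))"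
        "\<And>x. x \<in> K \<Longrightarrow> \<exists>!i. i < n \<and> x \<in> E i"
      using finite_cover_disjoint[OF T] by metis
    have Es: "E i \<in> sets \<mu>" if "i < n" for i
      using X(2) K unfolding E(1)[OF that] by (intro sets.Diff sets.Int sets.finite_UN) (auto simp: borel_compact)
    have Efin: "emeasure \<mu> (E i) < \<infinity>" if "i < n" for i
      using that E(1) by (intro le_less_trans[OF emeasure_mono emeasure_compact_finite[OF K]]) (auto simp: borel_compact K)
    have Eint: "integrable \<mu> (\<lambda>x. indicator (E i) x :: complex)" if "i < n" for i
      using integrable_of_real[OF integrable_real_indicator[OF Es[OF that] Efin[OF that]], where 'a=complex]
      by (simp add: of_real_indicator)
    have Emeas: "(LINT x|\<mu>. indicator (E i) x :: complex) = of_real (measure \<mu> (E i))" for i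
    proof -
      have "(LINT x|\<mu>. indicator (E i) x :: complex) = (LINT x|\<mu>. complex_of_real (indicator (E i) x))"
        by (simp only: of_real_indicator)
      also have "\<dots> = of_real (measure \<mu> (E i))"
        unfolding integral_complex_of_real by simp
      finally show ?thesis .
    qed
    define G where "G x y = (\<Sum>i<n. indicator (E i) x * F (t i) y)" for x y
    have G0: "G x y = 0" if "x \<notin> K" for x y
      unfolding G_def by (rule sum.neutral) (use that E(1) in \<open>auto simp: indicator_def\<close>)
    have G1: "\<exists>i<n. x \<in> E i \<and> (\<forall>y. G x y = F (t i) y)" if x: "x \<in> K" for x
    proof -
      obtain i where i: "i < n" "x \<in> E i" "\<And>j. j < n \<Longrightarrow> x \<in> E j \<Longrightarrow> j = i"
        using E(2)[OF x] by metis
      have "G x y = (\<Sum>j<n. if j = i then F (t i) y else 0)" for y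
        unfolding G_def
      proof (rule sum.cong[OF refl])
        fix j assume "j \<in> {..<n}"
        then have "x \<in> E j \<longleftrightarrow> j = i" using i by blast
        then show "indicator (E j) x * F (t j) y = (if j = i then F (t i) y else 0)"
          using i(2) by (cases "j = i") simp_all
      qed
      then have "G x y = F (t i) y" for y using i(1) by simp
      then show ?thesis using i(1,2) by blast
    qed
    have FG: "cmod (F x y - G x y) \<le> e" if x: "x \<in> K" for x y
    proof -
      obtain i where "i < n" "x \<in> E i" "\<forall>y. G x y = F (t i) y" using G1[OF x] by blast
      then show ?thesis using X(3)[of x "t i" y] E(1)[of i] by auto
    qed
    have FG0: "F x y = G x y" if "y \<notin> L" for x y
      unfolding G_def using supp that by (subst sum.neutral) auto
    have Gx: "integrable \<mu> (\<lambda>y. G x y)" for x unfolding G_def using intx by auto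
    have Gy: "integrable \<mu> (\<lambda>x. G x y)" for y unfolding G_def
      by (intro Bochner_Integration.integrable_sum integrable_mult_left Eint) simp
    have Gx': "(LINT y|\<mu>. G x y) = (\<Sum>i<n. indicator (E i) x * (LINT y|\<mu>. F (t i) y))" for x
      unfolding G_def using intx by simp
    have Gy': "(LINT x|\<mu>. G x y) = (\<Sum>i<n. measure \<mu> (E i) * F (t i) y)" for y
      unfolding G_def using Eint by (subst Bochner_Integration.integral_sum) (auto simp: Emeas)
    have "cmod (?I - (LINT x|\<mu>. LINT y|\<mu>. G x y)) \<le> (e * measure \<mu> L) * measure \<mu> K"
    proof (rule norm_integral_diff_le[OF int1 _ K])
      show "integrable \<mu> (\<lambda>x. LINT y|\<mu>. G x y)" unfolding Gx'
        by (intro Bochner_Integration.integrable_sum integrable_mult_left Eint) simp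
      show "(LINT y|\<mu>. F x y) = (LINT y|\<mu>. G x y)" if "x \<notin> K" for x
        using supp G0 that by (intro Bochner_Integration.integral_cong) auto
      show "cmod ((LINT y|\<mu>. F x y) - (LINT y|\<mu>. G x y)) \<le> e * measure \<mu> L" if "x \<in> K" for x
        using FG[OF that] FG0 by (intro norm_integral_diff_le[OF intx Gx L]) auto
    qed
    moreover have "cmod (?J - (LINT y|\<mu>. LINT x|\<mu>. G x y)) \<le> (e * measure \<mu> K) * measure \<mu> L"
    proof (rule norm_integral_diff_le[OF int2 _ L])
      show "integrable \<mu> (\<lambda>y. LINT x|\<mu>. G x y)" unfolding Gy' using intx by auto
      show "(LINT x|\<mu>. F x y) = (LINT x|\<mu>. G x y)" if "y \<notin> L" for y
        using FG0[OF that] by simp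
      show "cmod ((LINT x|\<mu>. F x y) - (LINT x|\<mu>. G x y)) \<le> e * measure \<mu> K" for y
        using FG G0 supp by (intro norm_integral_diff_le[OF inty Gy K]) (auto, metis)
    qed
    moreover have GG: "(LINT x|\<mu>. LINT y|\<mu>. G x y) = (LINT y|\<mu>. LINT x|\<mu>. G x y)"
    proof -
      have "(LINT x|\<mu>. LINT y|\<mu>. G x y) = (\<Sum>i<n. measure \<mu> (E i) * (LINT y|\<mu>. F (t i) y))"
        unfolding Gx' using Eint by (subst Bochner_Integration.integral_sum) (auto simp: Emeas)
      also have "\<dots> = (LINT y|\<mu>. LINT x|\<mu>. G x y)"
        unfolding Gy' using intx by (subst Bochner_Integration.integral_sum) auto
      finally show ?thesis .
    qed
    moreover have "cmod (?I - ?J) \<le> cmod (?I - g) + cmod (?J - g)" for g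
      using norm_triangle_ineq4[of "?I - g" "?J - g"] by simp
    note this[of "LINT y|\<mu>. LINT x|\<mu>. G x y"]
    ultimately have "cmod (?I - ?J) \<le> (e * measure \<mu> L) * measure \<mu> K + (e * measure \<mu> K) * measure \<mu> L"
      unfolding GG by linarith
    also have "\<dots> = e * (2 * measure \<mu> K * measure \<mu> L)" by simp
    finally show ?thesis .
  qed
  have "cmod (?I - ?J) \<le> 0"
  proof (rule field_le_epsilon)
    fix e :: real assume e: "e > 0"
    define m where "m = 2 * measure \<mu> K * measure \<mu> L"
    have m: "m \<ge> 0" by (simp add: m_def)
    have "cmod (?I - ?J) \<le> (e / (m + 1)) * m"
      unfolding m_def by (rule close) (use e in \<open>simp add: add_nonneg_pos\<close>)
    also have "\<dots> \<le> e" using e m by (simp add: field_simps)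
    finally show "cmod (?I - ?J) \<le> 0 + e" by simp
  qed
  then show ?thesis by simp
qed

section \<open>Invariance under inversion\<close>

lemma exists_Cc_integral_nonzero:
  obtains f where "f \<in> Cc" "(LINT x|\<mu>. f x) \<noteq> 0"
proof -
  have "emeasure \<mu> UNIV = (SUP K\<in>{K. compact K \<and> K \<subseteq> UNIV}. emeasure \<mu> K)" by (rule inner_regular) simp
  moreover have "emeasure \<mu> UNIV \<noteq> 0" using haar by (simp add: left_haar_measure_def)
  ultimately obtain K where K: "compact K" "emeasure \<mu> K \<noteq> 0"
    by (metis (mono_tags, lifting) SUP_bot bot_ennreal SUP_cong mem_Collect_eq)
  obtain g where g: "(\<lambda>x. complex_of_real (g x)) \<in> Cc" "\<And>x. 0 \<le> g x" "\<And>x. x \<in> K \<Longrightarrow> g x = 1"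
    by (rule Urysohn_locally_compact[OF locally_compact K(1) open_UNIV]) auto
  have "measure \<mu> K > 0"
    using K emeasure_compact_finite[OF K(1)] by (simp add: measure_def enn2real_positive_iff zero_less_iff_neq_zero)
  also have "measure \<mu> K = (LINT x|\<mu>. indicator K x)" using K by simp
  also have "\<dots> \<le> (LINT x|\<mu>. g x)"
    using g(2,3) integrable_Re[OF Cc_integrable[OF g(1)]]
    by (intro integral_mono integrable_indicator_compact[OF K(1)]) (auto simp: indicator_def)
  finally have "(LINT x|\<mu>. complex_of_real (g x)) \<noteq> 0" by simp
  with g(1) show thesis by (rule that)
qed

text \<open>The argument is that of uniqueness of Haar measure. Multiplied by the integral of an
  auxiliary \<open>f\<close>, both sides become the double integral of
  \<open>g (x - y) * f y\<close>: the left side by left invariance, Fubini and a right translation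
  of \<open>y\<close>, the right side by a right translation of \<open>x\<close>. The nonzero
  integral of \<open>f\<close> then cancels.\<close>

lemma integral_uminus_Cc:
  assumes g: "g \<in> Cc"
  shows "(LINT x|\<mu>. g (- x)) = (LINT x|\<mu>. g x)"
proof -
  obtain f where f: "f \<in> Cc" "(LINT x|\<mu>. f x) \<noteq> 0" by (rule exists_Cc_integral_nonzero)
  obtain Kf where Kf: "compact Kf" "{x. f x \<noteq> 0} \<subseteq> Kf" using f(1) by (rule CcE)
  obtain Kg where Kg: "compact Kg" "{x. g x \<noteq> 0} \<subseteq> Kg" using g by (rule CcE)
  \<comment> \<open>Contains the \<open>x\<close>-support of both kernels, as \<open>x\<close>
    equals \<open>- y + (y + x)\<close> in the first and \<open>(x - y) + y\<close> in the
    second.\<close>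
  define S where "S = (\<lambda>(x, y). x + y) ` (Kg \<times> Kf)"
  have S: "compact S" unfolding S_def by (rule compact_plus_group) fact+
  have "(LINT y|\<mu>. g (- y)) * (LINT x|\<mu>. f x) = (LINT y|\<mu>. LINT x|\<mu>. g (- y) * f (y + x))"
    using integral_left[OF Cc_measurable[OF f(1)]] by simp
  also have "\<dots> = (LINT x|\<mu>. LINT y|\<mu>. g (- y) * f (y + x))"
  proof (rule Fubini_Cc[OF _ compact_minus_group[OF Kg(1)] S])
    show "continuous_on UNIV (\<lambda>(y, x). g (- y) * f (y + x))"
      unfolding case_prod_unfold by (intro continuous_intros Cc_continuous_compose[OF f(1)] Cc_continuous_compose[OF g])
    show "y \<in> uminus ` Kg \<and> x \<in> S" if "g (- y) * f (y + x) \<noteq> 0" for y x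
    proof -
      have "- y \<in> Kg" "y + x \<in> Kf" using that Kf Kg by auto
      then have "- (- y) \<in> uminus ` Kg" "(\<lambda>(x, y). x + y) (- y, y + x) \<in> S" unfolding S_def by blast+
      then show ?thesis by (simp add: add.assoc[symmetric])
    qed
  qed
  also have "\<dots> = (LINT x|\<mu>. LINT y|\<mu>. g (x - y) * f y)"
  proof (rule Bochner_Integration.integral_cong[OF refl])
    fix x
    have "(LINT y|\<mu>. (\<lambda>y. g (x - y) * f y) (y + x)) = (LINT y|\<mu>. g (x - y) * f y)"
      by (intro integral_right continuous_measurable continuous_intros Cc_continuous_compose[OF f(1)] Cc_continuous_compose[OF g])
    then show "(LINT y|\<mu>. g (- y) * f (y + x)) = (LINT y|\<mu>. g (x - y) * f y)"
      by (simp add: diff_add_eq_diff_diff_swap)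
  qed
  also have "\<dots> = (LINT y|\<mu>. LINT x|\<mu>. g (x - y) * f y)"
  proof (rule Fubini_Cc[OF _ S Kf(1)])
    show "continuous_on UNIV (\<lambda>(x, y). g (x - y) * f y)"
      unfolding case_prod_unfold by (intro continuous_intros Cc_continuous_compose[OF f(1)] Cc_continuous_compose[OF g])
    show "x \<in> S \<and> y \<in> Kf" if "g (x - y) * f y \<noteq> 0" for x y
    proof -
      have "x - y \<in> Kg" "y \<in> Kf" using that Kf Kg by auto
      then have "(\<lambda>(x, y). x + y) (x - y, y) \<in> S" unfolding S_def by blast
      then show ?thesis using \<open>y \<in> Kf\<close> by simp
    qed
  qed
  also have "\<dots> = (LINT y|\<mu>. (LINT x|\<mu>. g x) * f y)"
  proof (rule Bochner_Integration.integral_cong[OF refl])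
    fix y
    show "(LINT x|\<mu>. g (x - y) * f y) = (LINT x|\<mu>. g x) * f y"
      using integral_right[OF Cc_measurable[OF g], of "- y"] by simp
  qed
  also have "\<dots> = (LINT x|\<mu>. g x) * (LINT x|\<mu>. f x)" by simp
  finally show ?thesis using f(2) by simp
qed

text \<open>By inner regularity it suffices to bound the measure of a compact \<open>K\<close>
  inside \<open>U\<close>. A Urysohn function between the indicators of \<open>K\<close> and
  \<open>U\<close> transfers the statement from integrals to measures.\<close>

lemma emeasure_open_le_uminus:
  assumes U: "open U" shows "emeasure \<mu> U \<le> emeasure \<mu> (uminus ` U)"
proof -
  have U': "open (uminus ` U)" by (rule open_uminus_image[OF U])
  have "emeasure \<mu> K \<le> emeasure \<mu> (uminus ` U)" if K: "compact K" "K \<subseteq> U" for K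
  proof (cases "emeasure \<mu> (uminus ` U) = \<infinity>")
    case False
    then have fin: "emeasure \<mu> (uminus ` U) < \<infinity>" by (simp add: less_top)
    obtain g where g: "(\<lambda>x. complex_of_real (g x)) \<in> Cc" "\<And>x. 0 \<le> g x" "\<And>x. g x \<le> 1"
        "\<And>x. x \<in> K \<Longrightarrow> g x = 1" "\<And>x. x \<notin> U \<Longrightarrow> g x = 0"
      using Urysohn_locally_compact[OF locally_compact K(1) U K(2)] by metis
    have int: "integrable \<mu> g"
      using integrable_Re[OF Cc_integrable[OF g(1)]] by simp
    have "measure \<mu> K = (LINT x|\<mu>. indicator K x)" using K by simp
    also have "\<dots> \<le> (LINT x|\<mu>. g x)"
      using g(2,4) by (intro integral_mono int integrable_indicator_compact[OF K(1)]) (auto simp: indicator_def)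
    also have "\<dots> = (LINT x|\<mu>. g (- x))"
      using integral_uminus_Cc[OF g(1)] by simp
    also have "\<dots> \<le> (LINT x|\<mu>. indicator (uminus ` U) x)"
    proof (rule integral_mono')
      show "integrable \<mu> (indicator (uminus ` U) :: 'a \<Rightarrow> real)"
        using fin U' by (intro integrable_real_indicator) auto
      show "g (- x) \<le> indicator (uminus ` U) x" for x
      proof (cases "- x \<in> U")
        case True
        then have "- (- x) \<in> uminus ` U" by (rule imageI)
        then show ?thesis using g(3) by simp
      qed (simp add: g(5))
    qed simp
    also have "\<dots> = measure \<mu> (uminus ` U)" using U' by simp
    finally show ?thesis
      using fin emeasure_compact_finite[OF K(1)] by (simp add: emeasure_eq_ennreal_measure less_top)
  qed simp
  then show ?thesis unfolding inner_regular[OF U] by (auto intro: SUP_least)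
qed

text \<open>The preceding inequality, applied to an open set and to its inverse, is an equality;
  outer regularity extends it to Borel sets.\<close>

lemma distr_uminus: "distr \<mu> \<mu> uminus = \<mu>"
proof (rule measure_eqI)
  have eq: "emeasure \<mu> (uminus ` U) = emeasure \<mu> U" if "open U" for U
    using emeasure_open_le_uminus[OF that] emeasure_open_le_uminus[OF open_uminus_image[OF that]]
    by (simp add: image_image)
  have le: "emeasure \<mu> (uminus ` A) \<le> emeasure \<mu> A" if A: "A \<in> sets borel" "uminus ` A \<in> sets borel" for A
    unfolding outer_regular[OF A(1)]
  proof (rule INF_greatest)
    fix U assume "U \<in> {U. open U \<and> A \<subseteq> U}"
    then have U: "open U" "A \<subseteq> U" by auto
    have "emeasure \<mu> (uminus ` A) \<le> emeasure \<mu> (uminus ` U)"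
      using U by (intro emeasure_mono image_mono) (simp_all add: borel_open open_uminus_image)
    then show "emeasure \<mu> (uminus ` A) \<le> emeasure \<mu> U" using eq[OF U(1)] by simp
  qed
  fix A assume "A \<in> sets (distr \<mu> \<mu> uminus)"
  then have A: "A \<in> sets borel" by simp
  have v: "uminus -` A = uminus ` A" by (auto simp: image_iff intro!: bexI[of _ "- _"])
  have A': "uminus ` A \<in> sets borel"
    using measurable_sets[OF measurable_uminus_haar, of A] A v by simp
  have "emeasure \<mu> (uminus ` A) = emeasure \<mu> A"
    using le[OF A A'] le[of "uminus ` A"] A A' by (simp add: image_image)
  then show "emeasure (distr \<mu> \<mu> uminus) A = emeasure \<mu> A"
    using A by (simp add: emeasure_distr v)
qed simp

lemma integral_uminus:
  fixes f :: "'a \<Rightarrow> 'b::{banach,second_countable_topology}"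
  assumes "f \<in> borel_measurable \<mu>"
  shows "(LINT y|\<mu>. f (- y)) = (LINT y|\<mu>. f y)"
  using integral_distr[OF measurable_uminus_haar assms] by (simp add: distr_uminus)

end

section \<open>Convolution on compactly supported functions\<close>

text \<open>The involution of the group algebra. For a unimodular group it carries no modular
  function and still represents the adjoint of convolution.\<close>

definition conv_star :: "('a::group_add \<Rightarrow> complex) \<Rightarrow> 'a \<Rightarrow> complex" where
  "conv_star f = (\<lambda>x. cnj (f (- x)))"

lemma conv_star_star [simp]: "conv_star (conv_star f) = f"
  by (simp add: conv_star_def)

context unimodular_haar
begin

abbreviation conv :: "('a \<Rightarrow> complex) \<Rightarrow> ('a \<Rightarrow> complex) \<Rightarrow> 'a \<Rightarrow> complex" where
  "conv \<equiv> convolution \<mu>"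

definition l1norm :: "('a \<Rightarrow> complex) \<Rightarrow> real" where
  "l1norm f = (LINT x|\<mu>. cmod (f x))"

lemma l1norm_nonneg [simp]: "0 \<le> l1norm f"
  by (simp add: l1norm_def)

lemma Cc_conv_star:
  fixes f :: "'a \<Rightarrow> complex"
  assumes "f \<in> Cc" shows "conv_star f \<in> Cc"
proof -
  obtain K where K: "compact K" "{x. f x \<noteq> 0} \<subseteq> K" using assms by (rule CcE)
  show ?thesis unfolding conv_star_def
  proof (rule CcI[OF _ compact_minus_group[OF K(1)]])
    show "continuous_on UNIV (\<lambda>x. cnj (f (- x)))"
      by (intro continuous_intros Cc_continuous_compose[OF assms])
    show "x \<in> uminus ` K" if "cnj (f (- x)) \<noteq> 0" for x
    proof -
      have "- (- x) \<in> uminus ` K" using that K(2) by (intro imageI) auto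
      then show ?thesis by simp
    qed
  qed
qed

lemma measurable_reflect_translate [measurable]: "(\<lambda>y. - y + x) \<in> measurable \<mu> \<mu>"
  using borel_measurable_continuous_onI[of "\<lambda>y. - y + x"]
  by (simp add: measurable_cong_sets[OF sets_haar sets_haar] continuous_intros)

lemma integral_reflect_translate:
  fixes f :: "'a \<Rightarrow> 'b::{banach,second_countable_topology}"
  assumes [measurable]: "f \<in> borel_measurable \<mu>"
  shows "(LINT y|\<mu>. f (- y + x)) = (LINT y|\<mu>. f y)"
proof -
  have "(LINT y|\<mu>. f (- y + x)) = (LINT y|\<mu>. f (y + x))"
    using integral_uminus[of "\<lambda>y. f (y + x)"] by simp
  also have "\<dots> = (LINT y|\<mu>. f y)" by (rule integral_right) measurable
  finally show ?thesis .
qed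

lemma distr_reflect_translate: "distr \<mu> \<mu> (\<lambda>y. - y + x) = \<mu>"
proof -
  have "distr (distr \<mu> \<mu> uminus) \<mu> (\<lambda>y. y + x) = distr \<mu> \<mu> ((\<lambda>y. y + x) \<circ> uminus)"
    by (rule distr_distr) measurable
  then show ?thesis by (simp add: distr_uminus distr_right o_def)
qed

lemma sq_integrable_reflect_translate:
  assumes "h \<in> sq_integrable \<mu>"
  shows "(\<lambda>y. h (- y + x)) \<in> sq_integrable \<mu>" "l2norm \<mu> (\<lambda>y. h (- y + x)) = l2norm \<mu> h"
proof -
  note [measurable] = sq_integrableD(1)[OF assms]
  have "integrable \<mu> (\<lambda>y. (cmod (h (- y + x)))\<^sup>2) \<longleftrightarrow> integrable (distr \<mu> \<mu> (\<lambda>y. - y + x)) (\<lambda>y. (cmod (h y))\<^sup>2)"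
    by (rule integrable_distr_eq[symmetric]) measurable
  then show "(\<lambda>y. h (- y + x)) \<in> sq_integrable \<mu>"
    using sq_integrableD[OF assms] by (simp add: sq_integrable_def distr_reflect_translate)
  show "l2norm \<mu> (\<lambda>y. h (- y + x)) = l2norm \<mu> h"
    unfolding l2norm_def by (subst integral_reflect_translate[where f="\<lambda>y. (cmod (h y))\<^sup>2"]) auto
qed

lemma sq_integrable_left:
  assumes "h \<in> sq_integrable \<mu>"
  shows "(\<lambda>y. h (x + y)) \<in> sq_integrable \<mu>" "l2norm \<mu> (\<lambda>y. h (x + y)) = l2norm \<mu> h"
proof -
  note [measurable] = sq_integrableD(1)[OF assms]
  have "integrable \<mu> (\<lambda>y. (cmod (h (x + y)))\<^sup>2) \<longleftrightarrow> integrable (distr \<mu> \<mu> (\<lambda>y. x + y)) (\<lambda>y. (cmod (h y))\<^sup>2)"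
    by (rule integrable_distr_eq[symmetric]) measurable
  then show "(\<lambda>y. h (x + y)) \<in> sq_integrable \<mu>"
    using sq_integrableD[OF assms] by (simp add: sq_integrable_def distr_left)
  show "l2norm \<mu> (\<lambda>y. h (x + y)) = l2norm \<mu> h"
    unfolding l2norm_def by (subst integral_left[where f="\<lambda>y. (cmod (h y))\<^sup>2"]) auto
qed

lemma conv_integrable:
  assumes "f \<in> sq_integrable \<mu>" "h \<in> sq_integrable \<mu>"
  shows "integrable \<mu> (\<lambda>y. f y * h (- y + x))"
  by (rule integrable_mult_sq_integrable[OF assms(1) sq_integrable_reflect_translate(1)[OF assms(2)]])

text \<open>Since \<open>y \<mapsto> - y + x\<close> preserves the measure, Cauchy-Schwarz applies
  at every single \<open>x\<close>. Hence convergence in norm of one factor makes the convolutions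
  converge uniformly.\<close>

lemma conv_sup_bound:
  assumes "f \<in> sq_integrable \<mu>" "h \<in> sq_integrable \<mu>"
  shows "cmod (conv f h x) \<le> l2norm \<mu> f * l2norm \<mu> h"
  using norm_integral_mult_le[OF assms(1) sq_integrable_reflect_translate(1)[OF assms(2), of x]]
  by (simp add: convolution_def sq_integrable_reflect_translate(2)[OF assms(2)])

lemma conv_diff_right:
  assumes "f \<in> sq_integrable \<mu>" "g \<in> sq_integrable \<mu>" "h \<in> sq_integrable \<mu>"
  shows "conv f (\<lambda>x. g x - h x) = (\<lambda>x. conv f g x - conv f h x)"
  unfolding convolution_def using conv_integrable[OF assms(1,2)] conv_integrable[OF assms(1,3)]
  by (simp add: right_diff_distrib)

lemma conv_diff_left:
  assumes "f \<in> sq_integrable \<mu>" "g \<in> sq_integrable \<mu>" "h \<in> sq_integrable \<mu>"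
  shows "conv (\<lambda>x. f x - g x) h = (\<lambda>x. conv f h x - conv g h x)"
  unfolding convolution_def using conv_integrable[OF assms(1,3)] conv_integrable[OF assms(2,3)]
  by (simp add: left_diff_distrib)

lemma conv_scale_right: "conv f (\<lambda>x. c * h x) = (\<lambda>x. c * conv f h x)"
  unfolding convolution_def by (simp add: mult.left_commute)

lemma conv_scale_left: "conv (\<lambda>x. c * f x) h = (\<lambda>x. c * conv f h x)"
  unfolding convolution_def by (simp add: mult.assoc)

text \<open>The convolutions agree at every point and not just almost everywhere, because
  \<open>y \<mapsto> - y + x\<close> pulls null sets back to null sets.\<close>

lemma conv_cong_AE:
  assumes "f \<in> borel_measurable \<mu>" "g \<in> borel_measurable \<mu>" "h \<in> borel_measurable \<mu>" "AE x in \<mu>. g x = h x"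
  shows "conv f g = conv f h"
proof
  fix x
  note [measurable] = assms(1-3)
  have "AE y in distr \<mu> \<mu> (\<lambda>y. - y + x). g y = h y"
    unfolding distr_reflect_translate by (rule assms(4))
  then have "AE y in \<mu>. g (- y + x) = h (- y + x)"
    by (subst (asm) AE_distr_iff) auto
  then have "AE y in \<mu>. f y * g (- y + x) = f y * h (- y + x)"
    by eventually_elim simp
  then show "conv f g x = conv f h x"
    unfolding convolution_def by (intro integral_cong_AE) auto
qed

lemma Cc_conv:
  assumes f: "f \<in> Cc" and g: "g \<in> Cc" shows "conv f g \<in> Cc"
proof -
  obtain K where K: "compact K" "{x. f x \<noteq> 0} \<subseteq> K" using f by (rule CcE)
  obtain L where L: "compact L" "{x. g x \<noteq> 0} \<subseteq> L" using g by (rule CcE)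
  define S where "S = (\<lambda>(x, y). x + y) ` (K \<times> L)"
  have S: "compact S" unfolding S_def by (rule compact_plus_group) fact+
  show ?thesis unfolding convolution_def
  proof (rule Cc_integral_param[OF _ S K(1)])
    show "continuous_on UNIV (\<lambda>(x, y). f y * g (- y + x))"
      unfolding case_prod_unfold by (intro continuous_intros Cc_continuous_compose[OF f] Cc_continuous_compose[OF g])
    show "x \<in> S \<and> y \<in> K" if "f y * g (- y + x) \<noteq> 0" for x y
    proof -
      have "y \<in> K" "- y + x \<in> L" using that K L by auto
      then have "(\<lambda>(x, y). x + y) (y, - y + x) \<in> S" unfolding S_def by blast
      then show ?thesis using \<open>y \<in> K\<close> by (simp add: add.assoc[symmetric])
    qed
  qed
qed

lemma conv_assoc:
  assumes f: "f \<in> Cc" and g: "g \<in> Cc" and h: "h \<in> Cc"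
  shows "conv (conv f g) h = conv f (conv g h)"
proof
  fix x
  obtain K where K: "compact K" "{x. f x \<noteq> 0} \<subseteq> K" using f by (rule CcE)
  obtain L where L: "compact L" "{x. g x \<noteq> 0} \<subseteq> L" using g by (rule CcE)
  define S where "S = (\<lambda>(x, y). x + y) ` (K \<times> L)"
  have S: "compact S" unfolding S_def by (rule compact_plus_group) fact+
  note cont = continuous_intros Cc_continuous_compose[OF f] Cc_continuous_compose[OF g] Cc_continuous_compose[OF h]
  have "conv f (conv g h) x = (LINT y|\<mu>. f y * (LINT u|\<mu>. g u * h (- u + (- y + x))))"
    by (simp add: convolution_def)
  also have "\<dots> = (LINT y|\<mu>. LINT u|\<mu>. f y * (g (- y + u) * h (- u + x)))"
  proof (rule Bochner_Integration.integral_cong[OF refl])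
    fix y
    have "(LINT u|\<mu>. (\<lambda>u. g u * h (- u + (- y + x))) (- y + u)) = (LINT u|\<mu>. g u * h (- u + (- y + x)))"
      by (intro integral_left continuous_measurable cont)
    then have "(LINT u|\<mu>. g u * h (- u + (- y + x))) = (LINT u|\<mu>. g (- y + u) * h (- u + x))"
      by (simp add: minus_add add.assoc)
    then show "f y * (LINT u|\<mu>. g u * h (- u + (- y + x))) = (LINT u|\<mu>. f y * (g (- y + u) * h (- u + x)))"
      by simp
  qed
  also have "\<dots> = (LINT u|\<mu>. LINT y|\<mu>. f y * (g (- y + u) * h (- u + x)))"
  proof (rule Fubini_Cc[OF _ K(1) S])
    show "continuous_on UNIV (\<lambda>(y, u). f y * (g (- y + u) * h (- u + x)))"
      unfolding case_prod_unfold by (intro cont)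
    show "y \<in> K \<and> u \<in> S" if "f y * (g (- y + u) * h (- u + x)) \<noteq> 0" for y u
    proof -
      have "y \<in> K" "- y + u \<in> L" using that K L by auto
      then have "(\<lambda>(x, y). x + y) (y, - y + u) \<in> S" unfolding S_def by blast
      then show ?thesis using \<open>y \<in> K\<close> by (simp add: add.assoc[symmetric])
    qed
  qed
  also have "\<dots> = conv (conv f g) h x"
    unfolding convolution_def by (simp add: mult.assoc[symmetric])
  finally show "conv (conv f g) h x = conv f (conv g h) x" ..
qed

section \<open>Adjoints of left and right convolution, and norm bounds\<close>

lemma l2inner_conv_swap:
  assumes f: "f \<in> Cc" and g: "g \<in> Cc" and h: "h \<in> Cc"
  shows "l2inner \<mu> (conv f g) h = (LINT y|\<mu>. f y * (LINT x|\<mu>. g (- y + x) * cnj (h x)))"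
proof -
  obtain K where K: "compact K" "{x. f x \<noteq> 0} \<subseteq> K" using f by (rule CcE)
  obtain L where L: "compact L" "{x. h x \<noteq> 0} \<subseteq> L" using h by (rule CcE)
  note cont = continuous_intros Cc_continuous_compose[OF f] Cc_continuous_compose[OF g] Cc_continuous_compose[OF h]
  have "l2inner \<mu> (conv f g) h = (LINT x|\<mu>. LINT y|\<mu>. f y * (g (- y + x) * cnj (h x)))"
    unfolding l2inner_def convolution_def by (simp add: mult.assoc[symmetric])
  also have "\<dots> = (LINT y|\<mu>. LINT x|\<mu>. f y * (g (- y + x) * cnj (h x)))"
  proof (rule Fubini_Cc[OF _ L(1) K(1)])
    show "continuous_on UNIV (\<lambda>(x, y). f y * (g (- y + x) * cnj (h x)))"
      unfolding case_prod_unfold by (intro cont)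
  qed (use K L in auto)
  finally show ?thesis by simp
qed

text \<open>The inner integral of \<open>l2inner_conv_swap\<close> already is the conjugate of
  \<open>conv h (conv_star g) y\<close>. Having adjoints on both sides, here and in
  \<open>l2inner_conv_left\<close>, is how the trace property is expressed.\<close>

lemma l2inner_conv_right:
  assumes f: "f \<in> Cc" and g: "g \<in> Cc" and h: "h \<in> Cc"
  shows "l2inner \<mu> (conv f g) h = l2inner \<mu> f (conv h (conv_star g))"
  unfolding l2inner_conv_swap[OF assms]
  unfolding l2inner_def convolution_def conv_star_def
  by (simp add: minus_add mult.commute flip: Bochner_Integration.integral_cnj)

lemma l2inner_conv_left:
  assumes f: "f \<in> Cc" and g: "g \<in> Cc" and h: "h \<in> Cc"
  shows "l2inner \<mu> (conv f g) h = l2inner \<mu> g (conv (conv_star f) h)"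
proof -
  obtain K where K: "compact K" "{x. f x \<noteq> 0} \<subseteq> K" using f by (rule CcE)
  obtain L where L: "compact L" "{x. g x \<noteq> 0} \<subseteq> L" using g by (rule CcE)
  note cont = continuous_intros Cc_continuous_compose[OF f] Cc_continuous_compose[OF g] Cc_continuous_compose[OF h]
  have "l2inner \<mu> (conv f g) h = (LINT y|\<mu>. f y * (LINT x|\<mu>. g (- y + x) * cnj (h x)))"
    by (rule l2inner_conv_swap[OF assms])
  also have "\<dots> = (LINT y|\<mu>. LINT x|\<mu>. f y * (g x * cnj (h (y + x))))"
  proof (rule Bochner_Integration.integral_cong[OF refl])
    fix y
    have "(LINT x|\<mu>. (\<lambda>x. g (- y + x) * cnj (h x)) (y + x)) = (LINT x|\<mu>. g (- y + x) * cnj (h x))"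
      by (intro integral_left continuous_measurable cont)
    then show "f y * (LINT x|\<mu>. g (- y + x) * cnj (h x)) = (LINT x|\<mu>. f y * (g x * cnj (h (y + x))))"
      by (simp add: add.assoc[symmetric])
  qed
  also have "\<dots> = (LINT x|\<mu>. LINT y|\<mu>. f y * (g x * cnj (h (y + x))))"
  proof (rule Fubini_Cc[OF _ K(1) L(1)])
    show "continuous_on UNIV (\<lambda>(y, x). f y * (g x * cnj (h (y + x))))"
      unfolding case_prod_unfold by (intro cont)
  qed (use K L in auto)
  also have "\<dots> = l2inner \<mu> g (conv (conv_star f) h)"
    unfolding l2inner_def
  proof (rule Bochner_Integration.integral_cong[OF refl])
    fix x
    have "(LINT y|\<mu>. (\<lambda>y. f y * cnj (h (y + x))) (- y)) = (LINT y|\<mu>. f y * cnj (h (y + x)))"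
      by (intro integral_uminus continuous_measurable cont)
    then have "(LINT y|\<mu>. f y * cnj (h (y + x))) = cnj (conv (conv_star f) h x)"
      unfolding convolution_def conv_star_def by (simp flip: Bochner_Integration.integral_cnj)
    then show "(LINT y|\<mu>. f y * (g x * cnj (h (y + x)))) = g x * cnj (conv (conv_star f) h x)"
      by (simp add: mult.left_commute[of _ "g x"])
  qed
  finally show ?thesis .
qed

lemma conv_star_conv:
  assumes f: "f \<in> Cc" and g: "g \<in> Cc"
  shows "conv_star (conv f g) = conv (conv_star g) (conv_star f)"
proof
  fix x
  note cont = continuous_intros Cc_continuous_compose[OF f] Cc_continuous_compose[OF g]
  have "(LINT y|\<mu>. (\<lambda>y. cnj (g (- y)) * cnj (f (- x + y))) (x + y)) = (LINT y|\<mu>. cnj (g (- y)) * cnj (f (- x + y)))"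
    by (intro integral_left continuous_measurable cont)
  then show "conv_star (conv f g) x = conv (conv_star g) (conv_star f) x"
    unfolding convolution_def conv_star_def
    by (simp add: minus_add add.assoc[symmetric] mult.commute flip: Bochner_Integration.integral_cnj)
qed

lemma l2norm_conv_star:
  assumes "f \<in> Cc" shows "l2norm \<mu> (conv_star f) = l2norm \<mu> f"
  unfolding l2norm_def conv_star_def complex_mod_cnj
  by (subst integral_uminus[where f="\<lambda>x. (cmod (f x))\<^sup>2"]) (use Cc_measurable[OF assms] in auto)

lemma l1norm_conv_star:
  assumes "f \<in> Cc" shows "l1norm (conv_star f) = l1norm f"
  unfolding l1norm_def conv_star_def complex_mod_cnj
  by (subst integral_uminus[where f="\<lambda>x. cmod (f x)"]) (use Cc_measurable[OF assms] in auto)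

text \<open>Duality: pair \<open>h = conv f g\<close> with itself, bring the integral over
  \<open>f\<close> to the outside, bound the inner integral by Cauchy-Schwarz uniformly in
  \<open>y\<close>, and cancel one factor \<open>l2norm \<mu> h\<close>.\<close>

lemma l2norm_conv_le:
  assumes f: "f \<in> Cc" and g: "g \<in> Cc"
  shows "l2norm \<mu> (conv f g) \<le> l1norm f * l2norm \<mu> g"
proof -
  define h where "h = conv f g"
  have h: "h \<in> Cc" unfolding h_def by (rule Cc_conv[OF f g])
  have bound: "cmod (LINT x|\<mu>. g (- y + x) * cnj (h x)) \<le> l2norm \<mu> g * l2norm \<mu> h" for y
    using l2inner_bound[OF sq_integrable_left(1)[OF Cc_sq_integrable[OF g]] Cc_sq_integrable[OF h], of "- y"]
    by (simp add: l2inner_def sq_integrable_left(2)[OF Cc_sq_integrable[OF g]])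
  have "(l2norm \<mu> h)\<^sup>2 = cmod (l2inner \<mu> h h)"
    by (simp add: l2inner_self norm_power)
  also have "\<dots> = cmod (LINT y|\<mu>. f y * (LINT x|\<mu>. g (- y + x) * cnj (h x)))"
    using l2inner_conv_swap[OF f g h] by (simp add: h_def)
  also have "\<dots> \<le> (LINT y|\<mu>. cmod (f y) * (l2norm \<mu> g * l2norm \<mu> h))"
  proof (rule order_trans[OF integral_norm_bound integral_mono])
    show "integrable \<mu> (\<lambda>y. cmod (f y) * (l2norm \<mu> g * l2norm \<mu> h))"
      using Cc_integrable[OF f] by auto
    show "cmod (f y * (LINT x|\<mu>. g (- y + x) * cnj (h x))) \<le> cmod (f y) * (l2norm \<mu> g * l2norm \<mu> h)" for y
      using bound by (simp add: norm_mult mult_left_mono)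
    obtain K where K: "compact K" "{x. f x \<noteq> 0} \<subseteq> K" using f by (rule CcE)
    obtain L where L: "compact L" "{x. h x \<noteq> 0} \<subseteq> L" using h by (rule CcE)
    have "(\<lambda>y. LINT x|\<mu>. f y * (g (- y + x) * cnj (h x))) \<in> Cc"
    proof (rule Cc_integral_param[OF _ K(1) L(1)])
      show "continuous_on UNIV (\<lambda>(y, x). f y * (g (- y + x) * cnj (h x)))"
        unfolding case_prod_unfold
        by (intro continuous_intros Cc_continuous_compose[OF f] Cc_continuous_compose[OF g] Cc_continuous_compose[OF h])
    qed (use K L in auto)
    from integrable_norm[OF Cc_integrable[OF this]]
    show "integrable \<mu> (\<lambda>y. cmod (f y * (LINT x|\<mu>. g (- y + x) * cnj (h x))))" by simp
  qed
  also have "\<dots> = (l1norm f * l2norm \<mu> g) * l2norm \<mu> h" by (simp add: l1norm_def)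
  finally have "l2norm \<mu> h * l2norm \<mu> h \<le> (l1norm f * l2norm \<mu> g) * l2norm \<mu> h"
    by (simp add: power2_eq_square)
  then show ?thesis unfolding h_def[symmetric]
    by (cases "l2norm \<mu> h = 0") (auto simp: mult_le_cancel_right less_le)
qed

text \<open>The involution reverses products and, the measure being invariant under inversion,
  preserves both norms.\<close>

lemma l2norm_conv_le_right:
  assumes f: "f \<in> Cc" and g: "g \<in> Cc"
  shows "l2norm \<mu> (conv f g) \<le> l2norm \<mu> f * l1norm g"
  using l2norm_conv_le[OF Cc_conv_star[OF g] Cc_conv_star[OF f]]
  by (simp add: conv_star_conv[OF f g, symmetric] l2norm_conv_star l1norm_conv_star Cc_conv f g mult.commute)

section \<open>Density of the range\<close>

text \<open>\<open>lop\<close> and \<open>rop\<close> are left and right multiplication by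
  \<open>f - z\<close> in the convolution algebra with a unit adjoined.\<close>

definition lop :: "('a \<Rightarrow> complex) \<Rightarrow> complex \<Rightarrow> ('a \<Rightarrow> complex) \<Rightarrow> 'a \<Rightarrow> complex" where
  "lop f z \<phi> = (\<lambda>x. conv f \<phi> x - z * \<phi> x)"

definition rop :: "('a \<Rightarrow> complex) \<Rightarrow> complex \<Rightarrow> ('a \<Rightarrow> complex) \<Rightarrow> 'a \<Rightarrow> complex" where
  "rop f z \<phi> = (\<lambda>x. conv \<phi> f x - z * \<phi> x)"

lemmas Cc_closed = Cc_conv Cc_conv_star Cc_diff Cc_add Cc_scale

lemma Cc_lop: "f \<in> Cc \<Longrightarrow> \<phi> \<in> Cc \<Longrightarrow> lop f z \<phi> \<in> Cc"
  unfolding lop_def by (intro Cc_closed)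

lemma Cc_rop: "f \<in> Cc \<Longrightarrow> \<phi> \<in> Cc \<Longrightarrow> rop f z \<phi> \<in> Cc"
  unfolding rop_def by (intro Cc_closed)

lemma conv_add_left:
  assumes "f \<in> sq_integrable \<mu>" "g \<in> sq_integrable \<mu>" "h \<in> sq_integrable \<mu>"
  shows "conv (\<lambda>x. f x + g x) h = (\<lambda>x. conv f h x + conv g h x)"
  using conv_diff_left[OF assms(1) sq_integrable_scale[OF assms(2), of "-1"] assms(3)]
  by (simp only: conv_scale_left) simp

lemma conv_add_right:
  assumes "f \<in> sq_integrable \<mu>" "g \<in> sq_integrable \<mu>" "h \<in> sq_integrable \<mu>"
  shows "conv f (\<lambda>x. g x + h x) = (\<lambda>x. conv f g x + conv f h x)"
  using conv_diff_right[OF assms(1,2) sq_integrable_scale[OF assms(3), of "-1"]]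
  by (simp only: conv_scale_right) simp

lemma lop_diff:
  assumes "f \<in> sq_integrable \<mu>" "\<phi> \<in> sq_integrable \<mu>" "\<psi> \<in> sq_integrable \<mu>"
  shows "lop f z (\<lambda>x. \<phi> x - \<psi> x) = (\<lambda>x. lop f z \<phi> x - lop f z \<psi> x)"
  unfolding lop_def conv_diff_right[OF assms] by (simp add: algebra_simps)

lemma lop_add:
  assumes "f \<in> sq_integrable \<mu>" "\<phi> \<in> sq_integrable \<mu>" "\<psi> \<in> sq_integrable \<mu>"
  shows "lop f z (\<lambda>x. \<phi> x + \<psi> x) = (\<lambda>x. lop f z \<phi> x + lop f z \<psi> x)"
  unfolding lop_def conv_add_right[OF assms] by (simp add: algebra_simps)

lemma lop_scale: "lop f z (\<lambda>x. c * \<phi> x) = (\<lambda>x. c * lop f z \<phi> x)"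
  unfolding lop_def conv_scale_right by (simp add: algebra_simps)

lemma rop_diff:
  assumes "f \<in> sq_integrable \<mu>" "\<phi> \<in> sq_integrable \<mu>" "\<psi> \<in> sq_integrable \<mu>"
  shows "rop f z (\<lambda>x. \<phi> x - \<psi> x) = (\<lambda>x. rop f z \<phi> x - rop f z \<psi> x)"
  unfolding rop_def conv_diff_left[OF assms(2,3,1)] by (simp add: algebra_simps)

lemma rop_scale: "rop f z (\<lambda>x. c * \<phi> x) = (\<lambda>x. c * rop f z \<phi> x)"
  unfolding rop_def conv_scale_left by (simp add: algebra_simps)

lemmas conv_linear = conv_diff_left conv_diff_right conv_add_left conv_add_right
  conv_scale_left conv_scale_right Cc_sq_integrable Cc_closed

lemma lop_rop_commute:
  assumes "f \<in> Cc" "g \<in> Cc" "\<phi> \<in> Cc"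
  shows "lop f z (rop g w \<phi>) = rop g w (lop f z \<phi>)"
  unfolding lop_def rop_def by (simp add: conv_linear assms conv_assoc fun_eq_iff algebra_simps)

lemma conv_lop:
  assumes "f \<in> Cc" "\<phi> \<in> Cc" "\<psi> \<in> Cc"
  shows "conv (lop f z \<phi>) \<psi> = lop f z (conv \<phi> \<psi>)"
  unfolding lop_def by (simp add: conv_linear assms conv_assoc)

text \<open>Associativity: a factor \<open>f - z\<close> at the right end of \<open>\<phi>\<close>
  moves to the left end of \<open>\<psi>\<close>.\<close>

lemma conv_rop:
  assumes "f \<in> Cc" "\<phi> \<in> Cc" "\<psi> \<in> Cc"
  shows "conv (rop f z \<phi>) \<psi> = conv \<phi> (lop f z \<psi>)"
  unfolding lop_def rop_def by (simp add: conv_linear assms conv_assoc)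

lemma l2inner_lop:
  assumes "f \<in> Cc" "\<phi> \<in> Cc" "\<psi> \<in> Cc"
  shows "l2inner \<mu> (lop f z \<phi>) \<psi> = l2inner \<mu> \<phi> (lop (conv_star f) (cnj z) \<psi>)"
  unfolding lop_def
  by (simp add: l2inner_diff_left l2inner_diff_right l2inner_scale_left l2inner_scale_right
      Cc_sq_integrable Cc_closed assms l2inner_conv_left)

lemma l2inner_rop:
  assumes "f \<in> Cc" "\<phi> \<in> Cc" "\<psi> \<in> Cc"
  shows "l2inner \<mu> (rop f z \<phi>) \<psi> = l2inner \<mu> \<phi> (rop (conv_star f) (cnj z) \<psi>)"
  unfolding rop_def
  by (simp add: l2inner_diff_left l2inner_diff_right l2inner_scale_left l2inner_scale_right
      Cc_sq_integrable Cc_closed assms l2inner_conv_right)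

lemma l2norm_lop_le:
  assumes "f \<in> Cc" "\<phi> \<in> Cc"
  shows "l2norm \<mu> (lop f z \<phi>) \<le> (l1norm f + cmod z) * l2norm \<mu> \<phi>"
proof -
  have "l2norm \<mu> (lop f z \<phi>) \<le> l2norm \<mu> (conv f \<phi>) + l2norm \<mu> (\<lambda>x. z * \<phi> x)"
    unfolding lop_def by (intro l2norm_triangle_diff Cc_sq_integrable Cc_closed assms)
  also have "\<dots> \<le> l1norm f * l2norm \<mu> \<phi> + cmod z * l2norm \<mu> \<phi>"
    using l2norm_conv_le[OF assms] by (simp add: l2norm_scale)
  finally show ?thesis by (simp add: algebra_simps)
qed

text \<open>One step of gradient descent for the squared norm of \<open>lop f z \<phi>\<close>.
  Expanding the square, the cross term contributes \<open>-2 / M\<close> times that squared norm and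
  the quadratic term at most \<open>1 / M\<close> times it, since \<open>M\<close> dominates the
  squared operator norm of the adjoint.\<close>

lemma l2norm_gradient_step:
  assumes f: "f \<in> Cc" and \<phi>: "\<phi> \<in> Cc" and M: "M > 0" "(l1norm (conv_star f) + cmod z)\<^sup>2 \<le> M"
  shows "(l2norm \<mu> (\<lambda>x. \<phi> x - of_real (1 / M) * lop (conv_star f) (cnj z) (lop f z \<phi>) x))\<^sup>2
    \<le> (l2norm \<mu> \<phi>)\<^sup>2 - (l2norm \<mu> (lop f z \<phi>))\<^sup>2 / M"
proof -
  define L where "L = lop f z \<phi>"
  define B where "B = lop (conv_star f) (cnj z) L"
  have C: "L \<in> Cc" "B \<in> Cc" unfolding L_def B_def by (intro Cc_lop Cc_conv_star f \<phi>)+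
  have "l2inner \<mu> \<phi> B = of_real ((l2norm \<mu> L)\<^sup>2)"
    using l2inner_lop[OF f \<phi> C(1), of z] by (simp add: B_def L_def[symmetric] l2inner_self)
  then have "l2inner \<mu> \<phi> (\<lambda>x. of_real (1 / M) * B x) = of_real ((l2norm \<mu> L)\<^sup>2 / M)"
    unfolding l2inner_scale_right by simp
  moreover have "(l2norm \<mu> (\<lambda>x. of_real (1 / M) * B x))\<^sup>2 \<le> (l2norm \<mu> L)\<^sup>2 / M"
  proof -
    have "(l2norm \<mu> B)\<^sup>2 \<le> ((l1norm (conv_star f) + cmod z) * l2norm \<mu> L)\<^sup>2"
      using l2norm_lop_le[OF Cc_conv_star[OF f] C(1), of "cnj z"] by (intro power_mono) (auto simp: B_def)
    also have "\<dots> \<le> M * (l2norm \<mu> L)\<^sup>2"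
      using M(2) by (simp add: power_mult_distrib mult_right_mono)
    finally have "(l2norm \<mu> B)\<^sup>2 / M\<^sup>2 \<le> M * (l2norm \<mu> L)\<^sup>2 / M\<^sup>2"
      by (rule divide_right_mono) simp
    also have "\<dots> = (l2norm \<mu> L)\<^sup>2 / M" using M(1) by (simp add: power2_eq_square)
    finally show ?thesis unfolding l2norm_scale using M(1) by (simp add: norm_divide power_divide)
  qed
  ultimately show ?thesis
    unfolding L_def[symmetric] B_def[symmetric]
    using l2norm_diff_power2[OF Cc_sq_integrable[OF \<phi>] Cc_sq_integrable[OF Cc_scale[OF C(2)]], of "of_real (1 / M)"]
    by simp
qed

text \<open>Write \<open>A = \<lambda>(f) - z\<close>. For \<open>r\<close> a polynomial with \<open>r(0) = 1\<close>, the sequences \<open>s n\<close> and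
  \<open>k n\<close> represent \<open>(1 - A\<^sup>* A / M) ^ n r(A\<^sup>* A)\<close> and \<open>(1 - A A\<^sup>* / M) ^ n r(A A\<^sup>*)\<close>, provided that
  \<open>s0\<close> and \<open>k0\<close> represent \<open>r(A\<^sup>* A)\<close> and \<open>r(A A\<^sup>*)\<close>. The trace property gives them equal norms. The
  first sequence decreases geometrically because \<open>A\<close> is bounded below, while \<open>1 - k n\<close> maps into the
  range of \<open>A\<close>, which is therefore dense.\<close>

lemma dense_range_of_representatives:
  assumes f: "f \<in> Cc" and k0: "k0 \<in> Cc" and s0: "s0 \<in> Cc"
    and Rk: "rop f z k0 = lop f z s0"
    and Rs: "rop (conv_star f) (cnj z) s0 = lop (conv_star f) (cnj z) k0"
    and norm0: "l2norm \<mu> k0 = l2norm \<mu> s0"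
    and range0: "\<And>\<phi>. \<phi> \<in> Cc \<Longrightarrow> \<exists>\<psi>\<in>Cc. (\<lambda>x. \<phi> x - conv k0 \<phi> x) = lop f z \<psi>"
    and c: "c > 0" "\<And>\<phi>. \<phi> \<in> Cc \<Longrightarrow> c * l2norm \<mu> \<phi> \<le> l2norm \<mu> (lop f z \<phi>)"
    and \<phi>: "\<phi> \<in> Cc" and e: "e > 0"
  shows "\<exists>\<psi>\<in>Cc. l2norm \<mu> (\<lambda>x. \<phi> x - lop f z \<psi> x) < e"
proof -
  define f' where "f' = conv_star f"
  define L where "L = lop f z"
  define L' where "L' = lop f' (cnj z)"
  define R where "R = rop f z"
  define R' where "R' = rop f' (cnj z)"
  \<comment> \<open>The sum in parentheses bounds the operator norm of \<open>L'\<close>; adding 1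
    keeps \<open>M\<close> positive when \<open>f\<close> and \<open>z\<close> vanish.\<close>
  define M where "M = (l1norm f' + cmod z)\<^sup>2 + 1"
  define a where "a = complex_of_real (1 / M)"
  have M: "M > 0" "(l1norm f' + cmod z)\<^sup>2 \<le> M" by (auto simp: M_def add_nonneg_pos)
  have f': "f' \<in> Cc" unfolding f'_def by (rule Cc_conv_star[OF f])
  note defs = L_def L'_def R_def R'_def
  have C: "L \<psi> \<in> Cc" "L' \<psi> \<in> Cc" "R \<psi> \<in> Cc" "R' \<psi> \<in> Cc" if "\<psi> \<in> Cc" for \<psi>
    unfolding defs by (intro Cc_lop Cc_rop f f' that)+
  have step: "X (\<lambda>x. \<phi> x - a * \<psi> x) = (\<lambda>x. X \<phi> x - a * X \<psi> x)"
    if "X \<in> {L, L', R, R'}" "\<phi> \<in> Cc" "\<psi> \<in> Cc" for X \<phi> \<psi>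
    using that unfolding defs
    by (auto simp: lop_diff rop_diff lop_scale rop_scale Cc_sq_integrable Cc_scale f f')
  have comm: "L (R \<psi>) = R (L \<psi>)" "L (R' \<psi>) = R' (L \<psi>)" "L' (R \<psi>) = R (L' \<psi>)" "L' (R' \<psi>) = R' (L' \<psi>)"
    if "\<psi> \<in> Cc" for \<psi>
    unfolding defs by (intro lop_rop_commute f f' that)+
  define s where "s n = ((\<lambda>\<psi> x. \<psi> x - a * L' (L \<psi>) x) ^^ n) s0" for n
  define k where "k n = ((\<lambda>\<psi> x. \<psi> x - a * R' (R \<psi>) x) ^^ n) k0" for n
  have s_Suc: "s (Suc n) = (\<lambda>x. s n x - a * L' (L (s n)) x)" for n by (simp add: s_def)
  have k_Suc: "k (Suc n) = (\<lambda>x. k n x - a * R' (R (k n)) x)" for n by (simp add: k_def)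
  have s: "s n \<in> Cc" for n
    by (induction n) (auto simp: s_Suc s0 C Cc_diff Cc_scale, simp add: s_def s0)
  have k: "k n \<in> Cc" for n
    by (induction n) (auto simp: k_Suc k0 C Cc_diff Cc_scale, simp add: k_def k0)
  \<comment> \<open>Write A for \<open>f - z\<close> and A' for its adjoint. The relations k A = A s
    and s A' = A' k are all that is retained of k = p(A A') and s = p(A' A). They persist because
    \<open>s\<close> is multiplied from the left by a polynomial in A' A and \<open>k\<close> from
    the right by the same polynomial in A A'.\<close>
  have inv: "R (k n) = L (s n) \<and> R' (s n) = L' (k n)" for n
  proof (induction n)
    case 0
    then show ?case using Rk Rs by (simp add: k_def s_def defs f'_def)
  next
    case (Suc n)
    then have IH: "R (k n) = L (s n)" "R' (s n) = L' (k n)" by auto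
    have "R (R' (L (s n))) = L (L' (L (s n)))"
      using IH C s k by (metis comm)
    moreover have "R' (L' (L (s n))) = L' (R' (R (k n)))"
      using IH C s k by (metis comm)
    ultimately show ?case
      using IH unfolding s_Suc k_Suc by (simp add: step C s k)
  qed
  \<comment> \<open>Adjointness moves the outer new factor to the other argument, where
    \<open>inv\<close> trades the right multiplication of \<open>k\<close> for the left
    multiplication of \<open>s\<close>. One index is raised at a time.\<close>
  have inner_step: "l2inner \<mu> (k (Suc m)) (k n) = l2inner \<mu> (s (Suc m)) (s n)"
    if "l2inner \<mu> (k m) (k n) = l2inner \<mu> (s m) (s n)" for m n
  proof -
    have "l2inner \<mu> (R' (R (k m))) (k n) = l2inner \<mu> (R (k m)) (R (k n))"
      unfolding R'_def using l2inner_rop[OF f' C(3)[OF k] k, of "cnj z"] by (simp add: f'_def R_def)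
    also have "\<dots> = l2inner \<mu> (L (s m)) (L (s n))" using inv by simp
    also have "\<dots> = l2inner \<mu> (L' (L (s m))) (s n)"
      unfolding L'_def using l2inner_lop[OF f' C(1)[OF s] s, of "cnj z"] by (simp add: f'_def L_def)
    finally show ?thesis
      using that by (simp add: k_Suc s_Suc l2inner_diff_left l2inner_scale_left Cc_sq_integrable Cc_scale C s k)
  qed
  have inner0: "l2inner \<mu> (k m) (k 0) = l2inner \<mu> (s m) (s 0)" for m
    by (induction m) (simp add: k_def s_def l2inner_self norm0, rule inner_step)
  have inner: "l2inner \<mu> (k m) (k n) = l2inner \<mu> (s m) (s n)" for m n
    by (induction m) (metis inner0 l2inner_cnj, rule inner_step)
  have norm_eq: "l2norm \<mu> (k n) = l2norm \<mu> (s n)" for n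
    using inner[of n n] by (simp add: l2inner_self flip: of_real_power)
  \<comment> \<open>The maximum makes \<open>q\<close> nonnegative without comparing
    \<open>c\<close> with \<open>M\<close>.\<close>
  define q where "q = max 0 (1 - c\<^sup>2 / M)"
  have q: "0 \<le> q" "q < 1" using c(1) M(1) by (auto simp: q_def)
  have contr: "(l2norm \<mu> (s (Suc n)))\<^sup>2 \<le> q * (l2norm \<mu> (s n))\<^sup>2" for n
  proof -
    have "(l2norm \<mu> (s (Suc n)))\<^sup>2 \<le> (l2norm \<mu> (s n))\<^sup>2 - (l2norm \<mu> (L (s n)))\<^sup>2 / M"
      unfolding s_Suc a_def defs f'_def
      by (rule l2norm_gradient_step[OF f s M[unfolded f'_def]])
    also have "\<dots> \<le> (l2norm \<mu> (s n))\<^sup>2 - (c * l2norm \<mu> (s n))\<^sup>2 / M"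
      using c(2)[OF s[of n]] c(1) M(1)
      by (intro diff_left_mono divide_right_mono power_mono) (auto simp: L_def)
    also have "\<dots> = (1 - c\<^sup>2 / M) * (l2norm \<mu> (s n))\<^sup>2"
      by (simp add: power_mult_distrib left_diff_distrib)
    also have "\<dots> \<le> q * (l2norm \<mu> (s n))\<^sup>2"
      by (intro mult_right_mono) (auto simp: q_def)
    finally show ?thesis .
  qed
  have geo: "(l2norm \<mu> (s n))\<^sup>2 \<le> q ^ n * (l2norm \<mu> s0)\<^sup>2" for n
  proof (induction n)
    case 0
    then show ?case by (simp add: s_def)
  next
    case (Suc n)
    have "(l2norm \<mu> (s (Suc n)))\<^sup>2 \<le> q * (q ^ n * (l2norm \<mu> s0)\<^sup>2)"
      using contr[of n] mult_left_mono[OF Suc q(1)] by linarith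
    then show ?case by simp
  qed
  have "(\<lambda>n. q ^ n * (l2norm \<mu> s0)\<^sup>2) \<longlonglongrightarrow> 0 * (l2norm \<mu> s0)\<^sup>2"
    using q by (intro tendsto_intros LIMSEQ_power_zero) auto
  then have "(\<lambda>n. (l2norm \<mu> (s n))\<^sup>2) \<longlonglongrightarrow> 0"
    by (rule Lim_null_comparison[rotated, OF tendsto_eq_rhs]) (use geo in auto)
  then have "(\<lambda>n. sqrt ((l2norm \<mu> (s n))\<^sup>2)) \<longlonglongrightarrow> sqrt 0" by (rule tendsto_real_sqrt)
  then have "(\<lambda>n. l2norm \<mu> (s n) * l1norm \<phi>) \<longlonglongrightarrow> 0 * l1norm \<phi>" by (intro tendsto_intros) simp
  then have "\<forall>\<^sub>F n in sequentially. l2norm \<mu> (s n) * l1norm \<phi> < e"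
    using e by (auto dest: order_tendstoD(2))
  then obtain n where n: "l2norm \<mu> (s n) * l1norm \<phi> < e" by (auto simp: eventually_sequentially)
  have "\<exists>\<psi>\<in>Cc. (\<lambda>x. \<phi> x - conv (k n) \<phi> x) = L \<psi>" for n
  proof (induction n)
    case 0
    then show ?case using range0[OF \<phi>] by (simp add: k_def L_def)
  next
    case (Suc n)
    then obtain \<psi> where \<psi>: "\<psi> \<in> Cc" "(\<lambda>x. \<phi> x - conv (k n) \<phi> x) = L \<psi>" by blast
    \<comment> \<open>By \<open>inv\<close> and associativity, k A A' \<phi> = A s A' \<phi>, so
      each step changes \<open>conv (k n) \<phi>\<close> by an element of the range;
      \<open>\<eta>\<close> is its preimage.\<close>
    define \<eta> where "\<eta> = conv (s n) (L' \<phi>)"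
    have \<eta>: "\<eta> \<in> Cc" unfolding \<eta>_def by (intro Cc_conv s C \<phi>)
    have "conv (R' (R (k n))) \<phi> = conv (L (s n)) (L' \<phi>)"
      unfolding R'_def L'_def using inv[of n] by (simp add: conv_rop f' C s \<phi>)
    also have "\<dots> = L \<eta>" unfolding \<eta>_def L_def by (rule conv_lop[OF f s C(2)[OF \<phi>]])
    finally have eq: "conv (R' (R (k n))) \<phi> = L \<eta>" .
    have "conv (k (Suc n)) \<phi> = (\<lambda>x. conv (k n) \<phi> x - a * L \<eta> x)"
      unfolding k_Suc by (simp add: conv_diff_left conv_scale_left Cc_sq_integrable Cc_scale C k \<phi> eq)
    then have "(\<lambda>x. \<phi> x - conv (k (Suc n)) \<phi> x) = (\<lambda>x. L \<psi> x + a * L \<eta> x)"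
      unfolding \<psi>(2)[symmetric] by (simp add: algebra_simps)
    also have "\<dots> = L (\<lambda>x. \<psi> x + a * \<eta> x)"
      unfolding L_def by (simp add: lop_add lop_scale Cc_sq_integrable Cc_scale f \<psi>(1) \<eta>)
    finally show ?case using \<psi>(1) \<eta> by (intro bexI[of _ "\<lambda>x. \<psi> x + a * \<eta> x"] Cc_add Cc_scale)
  qed
  then obtain \<psi> where \<psi>: "\<psi> \<in> Cc" "(\<lambda>x. \<phi> x - conv (k n) \<phi> x) = L \<psi>" by blast
  have "(\<lambda>x. \<phi> x - L \<psi> x) = conv (k n) \<phi>" unfolding \<psi>(2)[symmetric] by simp
  then have "l2norm \<mu> (\<lambda>x. \<phi> x - L \<psi> x) \<le> l2norm \<mu> (s n) * l1norm \<phi>"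
    using l2norm_conv_le_right[OF k \<phi>, of n] norm_eq by simp
  with n \<psi>(1) show ?thesis unfolding L_def by (intro bexI[of _ \<psi>]) auto
qed

text \<open>With a unit adjoined, the two arguments are zw - (f - z)(g - w) and zw - (g - w)(f - z),
  whence multiplying the first by f - z on the right equals multiplying the second by f - z on the
  left.\<close>

lemma rop_eq_lop:
  assumes f: "f \<in> Cc" and g: "g \<in> Cc"
  shows "rop f z (\<lambda>x. z * g x + w * f x - conv f g x) = lop f z (\<lambda>x. z * g x + w * f x - conv g f x)"
  unfolding lop_def rop_def by (simp add: conv_linear f g conv_assoc fun_eq_iff algebra_simps)

text \<open>The trace property for the starting elements. With \<open>g = conv_star f\<close>, both
  products have squared norm \<open>l2inner \<mu> f (conv f (conv g f))\<close>, and their inner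
  products with \<open>f\<close> and with \<open>g\<close> agree as well; nothing else enters when
  the squares are expanded.\<close>

lemma l2norm_conv_star_swap:
  assumes f: "f \<in> Cc"
  shows "l2norm \<mu> (\<lambda>x. z * conv_star f x + w * f x - conv f (conv_star f) x)
    = l2norm \<mu> (\<lambda>x. z * conv_star f x + w * f x - conv (conv_star f) f x)"
proof -
  define g where "g = conv_star f"
  have g: "g \<in> Cc" and gs: "conv_star g = f" unfolding g_def using f by (auto intro: Cc_conv_star)
  note adj = l2inner_conv_left l2inner_conv_right
  define p where "p x = z * g x + w * f x" for x
  have p: "p \<in> Cc" unfolding p_def by (intro Cc_closed f g)
  have "l2inner \<mu> (conv f g) (conv f g) = l2inner \<mu> f (conv (conv f g) f)"
    using l2inner_conv_right[OF f g Cc_conv[OF f g]] by (simp add: gs)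
  also have "\<dots> = l2inner \<mu> (conv g f) (conv g f)"
    using l2inner_conv_left[OF g f Cc_conv[OF g f]] by (simp add: gs conv_assoc f g)
  finally have 1: "(l2norm \<mu> (conv f g))\<^sup>2 = (l2norm \<mu> (conv g f))\<^sup>2"
    by (simp add: l2inner_self flip: of_real_power)
  have ff: "l2inner \<mu> (conv f g) f = l2inner \<mu> (conv g f) f"
    using l2inner_conv_right[OF f g f] l2inner_conv_left[OF g f f] by (simp add: gs)
  have gg: "l2inner \<mu> (conv f g) g = l2inner \<mu> (conv g f) g"
    using l2inner_conv_left[OF f g g] l2inner_conv_right[OF g f g] by (simp add: g_def[symmetric])
  have expand: "l2inner \<mu> p h = z * cnj (l2inner \<mu> h g) + w * cnj (l2inner \<mu> h f)" if "h \<in> Cc" for h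
  proof -
    have "l2inner \<mu> (\<lambda>x. z * g x - (- w) * f x) h = z * l2inner \<mu> g h - (- w) * l2inner \<mu> f h"
      by (simp only: l2inner_diff_left l2inner_scale_left Cc_sq_integrable Cc_scale f g that)
    then show ?thesis unfolding p_def by (simp add: l2inner_cnj[of \<mu> h])
  qed
  have "l2inner \<mu> p (conv f g) = l2inner \<mu> p (conv g f)"
    by (simp add: expand Cc_conv f g ff gg)
  then have "(l2norm \<mu> (\<lambda>x. p x - conv f g x))\<^sup>2 = (l2norm \<mu> (\<lambda>x. p x - conv g f x))\<^sup>2"
    using 1 by (simp add: l2norm_diff_power2 Cc_sq_integrable p Cc_conv f g)
  then show ?thesis unfolding p_def g_def by simp
qed

lemma dense_range_nonzero:
  assumes f: "f \<in> Cc" and z: "z \<noteq> 0"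
    and c: "c > 0" "\<And>\<phi>. \<phi> \<in> Cc \<Longrightarrow> c * l2norm \<mu> \<phi> \<le> l2norm \<mu> (lop f z \<phi>)"
    and \<phi>: "\<phi> \<in> Cc" and e: "e > 0"
  shows "\<exists>\<psi>\<in>Cc. l2norm \<mu> (\<lambda>x. \<phi> x - lop f z \<psi> x) < e"
proof -
  define g where "g = conv_star f"
  have g: "g \<in> Cc" and gs: "conv_star g = f" unfolding g_def using f by (auto intro: Cc_conv_star)
  \<comment> \<open>\<open>b\<close> is 1 / |z|^2, and \<open>k0\<close> and \<open>s0\<close> are 1
    - b A A' and 1 - b A' A with A = f - z: the scalar terms cancel, leaving elements of
    \<open>Cc\<close>. Since 1 - \<open>k0\<close> is b A A', the preimage required below is b A'
    \<phi>.\<close>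
  define b where "b = 1 / (z * cnj z)"
  define k0 where "k0 = (\<lambda>x. b * (z * g x + cnj z * f x - conv f g x))"
  define s0 where "s0 = (\<lambda>x. b * (z * g x + cnj z * f x - conv g f x))"
  have bz: "b * (z * (cnj z * t)) = t" for t using z by (simp add: b_def)
  show ?thesis
  proof (rule dense_range_of_representatives[OF f _ _ _ _ _ _ c \<phi> e, of k0 s0])
    show "k0 \<in> Cc" "s0 \<in> Cc" unfolding k0_def s0_def by (intro Cc_closed f g)+
    show "rop f z k0 = lop f z s0"
      unfolding k0_def s0_def rop_scale lop_scale rop_eq_lop[OF f g] ..
    show "rop (conv_star f) (cnj z) s0 = lop (conv_star f) (cnj z) k0"
      unfolding k0_def s0_def rop_scale lop_scale g_def[symmetric]
      using rop_eq_lop[OF g f, of "cnj z" z] by (simp add: add.commute)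
    show "l2norm \<mu> k0 = l2norm \<mu> s0"
      unfolding k0_def s0_def l2norm_scale g_def l2norm_conv_star_swap[OF f] ..
    show "\<exists>\<psi>\<in>Cc. (\<lambda>x. \<phi> x - conv k0 \<phi> x) = lop f z \<psi>" if "\<phi> \<in> Cc" for \<phi>
    proof
      show "(\<lambda>x. b * lop g (cnj z) \<phi> x) \<in> Cc" by (intro Cc_scale Cc_lop g that)
      have "lop f z (lop g (cnj z) \<phi>) =
          (\<lambda>x. conv (conv f g) \<phi> x - cnj z * conv f \<phi> x - z * conv g \<phi> x + z * cnj z * \<phi> x)"
        unfolding lop_def by (simp add: conv_linear f g that conv_assoc fun_eq_iff algebra_simps)
      moreover have "conv k0 \<phi> =
          (\<lambda>x. b * (z * conv g \<phi> x + cnj z * conv f \<phi> x - conv (conv f g) \<phi> x))"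
        unfolding k0_def by (simp add: conv_linear f g that)
      ultimately show "(\<lambda>x. \<phi> x - conv k0 \<phi> x) = lop f z (\<lambda>x. b * lop g (cnj z) \<phi> x)"
        unfolding lop_scale by (simp add: bz algebra_simps)
    qed
  qed
qed

section \<open>Mass of points and the case z = 0\<close>

lemma emeasure_left_translate: "A \<in> sets borel \<Longrightarrow> emeasure \<mu> ((\<lambda>y. x + y) ` A) = emeasure \<mu> A"
  using haar by (auto simp: left_haar_measure_def left_invariant_def)

text \<open>Finitely many translates of a nonempty open set cover any given compact set. If the open
  set were null, all compact sets and then, by inner regularity, the whole group would be
  null.\<close>

lemma emeasure_open_pos:
  assumes V: "open V" "V \<noteq> {}" shows "emeasure \<mu> V > 0"
proof (rule ccontr)
  assume "\<not> emeasure \<mu> V > 0"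
  then have V0: "emeasure \<mu> V = 0" by (simp add: zero_less_iff_neq_zero)
  obtain v where v: "v \<in> V" using V by blast
  have op: "open ((\<lambda>y. x + y) ` V)" for x
  proof -
    have "(\<lambda>y. x + y) ` V = (\<lambda>y. - x + y) -` V"
      by (auto simp: add.assoc[symmetric] image_iff intro!: bexI[of _ "- x + _"])
    moreover have "open ((\<lambda>y. - x + y) -` V)" using V(1) by (rule open_vimage) (intro continuous_intros)
    ultimately show ?thesis by simp
  qed
  have "emeasure \<mu> K = 0" if K: "compact K" for K
  proof -
    have "x \<in> (\<lambda>y. (x - v) + y) ` V" for x using v by (auto intro!: image_eqI[of _ _ v])
    then have "K \<subseteq> (\<Union>x\<in>UNIV. (\<lambda>y. x + y) ` V)" by blast
    then obtain T where T: "finite T" "K \<subseteq> (\<Union>x\<in>T. (\<lambda>y. x + y) ` V)"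
      by (rule compactE_image[OF K op])
    have "emeasure \<mu> K \<le> emeasure \<mu> (\<Union>x\<in>T. (\<lambda>y. x + y) ` V)"
      using op T by (intro emeasure_mono) (auto intro!: borel_open open_UN)
    also have "\<dots> \<le> (\<Sum>x\<in>T. emeasure \<mu> ((\<lambda>y. x + y) ` V))"
      using op T(1) by (intro emeasure_subadditive_finite) auto
    also have "\<dots> = 0" using V V0 by (simp add: emeasure_left_translate)
    finally show ?thesis by simp
  qed
  then have "emeasure \<mu> UNIV \<le> 0"
    unfolding inner_regular[OF open_UNIV] by (intro SUP_least) simp
  then show False using haar by (simp add: left_haar_measure_def)
qed

text \<open>If points are null, outer regularity provides neighbourhoods \<open>U\<close> of 0 of
  arbitrarily small measure. A function \<open>\<phi>\<close> supported in \<open>U\<close> has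
  \<open>l1norm \<phi>\<close> at most \<open>sqrt (measure \<mu> U)\<close> times its
  \<open>l2norm\<close>, so that \<open>l2norm_conv_le_right\<close> contradicts the lower
  bound.\<close>

lemma not_bounded_below_if_nondiscrete:
  assumes f: "f \<in> Cc" and null: "emeasure \<mu> {0} = 0"
    and c: "c > 0" "\<And>\<phi>. \<phi> \<in> Cc \<Longrightarrow> c * l2norm \<mu> \<phi> \<le> l2norm \<mu> (conv f \<phi>)"
  shows False
proof -
  \<comment> \<open>Chosen so that \<open>l2norm \<mu> f * d < c\<close>; adding 1 gives strictness
    and covers \<open>f\<close> of norm zero.\<close>
  define d where "d = c / (l2norm \<mu> f + 1)"
  have d: "d > 0" using c by (simp add: d_def add_nonneg_pos)
  have "emeasure \<mu> {0} < ennreal (d\<^sup>2)" using null d by simp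
  then obtain U where U: "open U" "0 \<in> U" "emeasure \<mu> U < ennreal (d\<^sup>2)"
    by (subst (asm) outer_regular) (auto simp: INF_less_iff)
  have Ufin: "emeasure \<mu> U < \<infinity>" using U(3) by (rule less_trans) simp
  have "compact {0::'a}" by simp
  then obtain g where g: "(\<lambda>x. complex_of_real (g x)) \<in> Cc" "\<And>x. x \<in> {0} \<Longrightarrow> g x = 1" "\<And>x. x \<notin> U \<Longrightarrow> g x = 0"
    by (rule Urysohn_locally_compact[OF locally_compact _ U(1)]) (use U in auto)
  define \<phi> where "\<phi> x = complex_of_real (g x)" for x
  have \<phi>: "\<phi> \<in> Cc" using g(1) unfolding \<phi>_def .
  have pos: "l2norm \<mu> \<phi> > 0"
  proof (rule ccontr)
    assume "\<not> l2norm \<mu> \<phi> > 0"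
    then have "l2norm \<mu> \<phi> = 0" using l2norm_nonneg[of \<mu> \<phi>] by linarith
    then have "AE x in \<mu>. \<phi> x = 0" using l2norm_eq_0_iff[OF Cc_sq_integrable[OF \<phi>]] by simp
    moreover have op: "open {x. \<phi> x \<noteq> 0}"
      using Cc_continuous[OF \<phi>] by (intro open_Collect_neq continuous_intros)
    ultimately have "emeasure \<mu> {x. \<phi> x \<noteq> 0} = 0"
      by (subst (asm) AE_iff_measurable[OF _ refl]) auto
    moreover have "0 \<in> {x. \<phi> x \<noteq> 0}" using g(2) by (simp add: \<phi>_def)
    ultimately show False using emeasure_open_pos[OF op] by fastforce
  qed
  have ind: "(\<lambda>x. indicator U x) \<in> sq_integrable \<mu>" "l2norm \<mu> (\<lambda>x. indicator U x) < d"
  proof -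
    have "integrable \<mu> (indicator U :: 'a \<Rightarrow> real)"
      using U Ufin by (intro integrable_real_indicator) auto
    moreover have "(\<lambda>x. (cmod (indicator U x))\<^sup>2) = (indicator U :: 'a \<Rightarrow> real)"
      by (auto simp: indicator_def)
    note sq = this
    ultimately show "(\<lambda>x. indicator U x) \<in> sq_integrable \<mu>"
      using U(1) by (simp add: sq_integrable_def borel_measurable_indicator)
    have "l2norm \<mu> (\<lambda>x. indicator U x) = sqrt (measure \<mu> U)"
      unfolding l2norm_def sq using U(1) by simp
    also have "\<dots> < sqrt (d\<^sup>2)"
    proof (rule real_sqrt_less_mono)
      show "measure \<mu> U < d\<^sup>2"
        using U(3) Ufin by (simp add: emeasure_eq_ennreal_measure less_top ennreal_less_iff)
    qed
    finally show "l2norm \<mu> (\<lambda>x. indicator U x) < d" using d by simp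
  qed
  have "l1norm \<phi> = (LINT x|\<mu>. cmod (\<phi> x) * cmod (indicator U x))"
    unfolding l1norm_def using g(3) by (intro Bochner_Integration.integral_cong) (auto simp: \<phi>_def indicator_def)
  also have "\<dots> \<le> l2norm \<mu> \<phi> * l2norm \<mu> (\<lambda>x. indicator U x)"
    by (rule sq_integrable_cmod_mult(2)[OF Cc_sq_integrable[OF \<phi>] ind(1)])
  also have "\<dots> \<le> l2norm \<mu> \<phi> * d" using ind(2) by (intro mult_left_mono) auto
  finally have l1: "l1norm \<phi> \<le> l2norm \<mu> \<phi> * d" .
  have "c * l2norm \<mu> \<phi> \<le> l2norm \<mu> f * (l2norm \<mu> \<phi> * d)"
    using c(2)[OF \<phi>] l2norm_conv_le_right[OF f \<phi>] mult_left_mono[OF l1, of "l2norm \<mu> f"] by simp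
  then have "c * l2norm \<mu> \<phi> \<le> (l2norm \<mu> f * d) * l2norm \<mu> \<phi>" by (simp add: mult_ac)
  then have "c \<le> l2norm \<mu> f * d" using pos by (simp add: mult_le_cancel_right)
  also have "\<dots> < (l2norm \<mu> f + 1) * d" using d by simp
  also have "\<dots> = c"
  proof -
    have "l2norm \<mu> f + 1 \<noteq> 0" using l2norm_nonneg[of \<mu> f] by linarith
    then show ?thesis by (simp add: d_def)
  qed
  finally show False by simp
qed

lemma emeasure_singleton: "emeasure \<mu> {x} = emeasure \<mu> {0}"
  using emeasure_left_translate[of "{0}" x] by simp

text \<open>All points have the same positive mass, so a compact set, having finite measure, is
  finite. A compact neighbourhood of 0 is then finite, and removing its other points leaves an open
  set.\<close>

lemma open_singleton_if_atom:
  assumes "emeasure \<mu> {0} \<noteq> 0" shows "open {0::'a}"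
proof -
  define m where "m = measure \<mu> {0}"
  have fin0: "emeasure \<mu> {0} < \<infinity>" by (rule emeasure_compact_finite) simp
  have m: "emeasure \<mu> {x} = ennreal m" for x
    unfolding emeasure_singleton[of x] m_def using fin0 by (simp add: emeasure_eq_ennreal_measure less_top)
  have m0: "m > 0" using m[of 0] assms by (metis ennreal_eq_0_iff not_le)
  have fin: "finite K" if K: "compact K" for K :: "'a set"
  proof (rule ccontr)
    assume inf: "infinite K"
    obtain n :: nat where n: "measure \<mu> K / m < real n" using reals_Archimedean2 by blast
    obtain F where F: "F \<subseteq> K" "finite F" "card F = n" using infinite_arbitrarily_large[OF inf] by blast
    have "emeasure \<mu> F = (\<Sum>x\<in>F. emeasure \<mu> {x})" using F by (intro emeasure_eq_sum_singleton) auto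
    also have "\<dots> = ennreal (real n * m)" using m0 F by (simp add: m ennreal_mult ennreal_of_nat_eq_real_of_nat)
    finally have "ennreal (real n * m) \<le> emeasure \<mu> K"
      using emeasure_mono[OF F(1) compact_sets[OF K]] by simp
    then have "real n * m \<le> measure \<mu> K"
      using emeasure_compact_finite[OF K] by (simp add: emeasure_eq_ennreal_measure less_top)
    then show False using n m0 by (simp add: field_simps)
  qed
  obtain U K :: "'a set" where U: "open U" "compact K" "0 \<in> U" "U \<subseteq> K"
  proof -
    have "\<forall>x::'a. \<exists>U K. open U \<and> compact K \<and> x \<in> U \<and> U \<subseteq> K"
      using locally_compact by (simp add: locally_compact_space_def flip: open_openin)
    then show thesis using that by blast
  qed
  have "closed (K - {0})" using fin[OF U(2)] by (intro finite_imp_closed) simp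
  then have "open (U - (K - {0}))" using U by (intro open_Diff)
  moreover have "U - (K - {0}) = {0}" using U by auto
  ultimately show ?thesis by simp
qed

text \<open>The point function at 0 divided by the common mass of the points. It is continuous since
  singletons are open, and it is a unit for arbitrary functions.\<close>

lemma exists_unit_if_atom:
  assumes "emeasure \<mu> {0} \<noteq> 0"
  obtains \<delta> where "\<delta> \<in> Cc" "\<forall>\<phi>. conv \<delta> \<phi> = \<phi>" "\<forall>\<phi>. conv \<phi> \<delta> = \<phi>"
proof -
  define m where "m = measure \<mu> {0}"
  have fin: "emeasure \<mu> {x} < \<infinity>" for x by (rule emeasure_compact_finite) simp
  have m: "measure \<mu> {x} = m" for x
    by (simp add: measure_def m_def emeasure_singleton[of x])
  have "m > 0" unfolding m_def measure_def using fin[of 0] assms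
    by (simp add: enn2real_positive_iff zero_less_iff_neq_zero)
  then have m0: "complex_of_real m \<noteq> 0" by simp
  define \<delta> where "\<delta> x = (if x = 0 then 1 / complex_of_real m else 0)" for x :: 'a
  have sing: "(LINT y|\<mu>. (if y = x then b else 0)) = m * b" for x and b :: complex
  proof -
    have "(LINT y|\<mu>. (if y = x then b else 0)) = (LINT y|\<mu>. indicator {x} y *\<^sub>R b)"
      by (intro Bochner_Integration.integral_cong) (auto simp: indicator_def)
    also have "\<dots> = measure \<mu> {x} *\<^sub>R b"
      using fin[of x] by (subst integral_scaleR_left) auto
    finally show ?thesis by (simp add: m scaleR_conv_of_real)
  qed
  show thesis
  proof
    have "continuous_on ({0} \<union> - {0}) \<delta>"
    proof (rule continuous_on_open_Un)
      show "open {0::'a}" by (rule open_singleton_if_atom[OF assms])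
      show "continuous_on (- {0}) \<delta>"
        by (rule continuous_on_eq[of _ "\<lambda>_. 0"]) (auto simp: \<delta>_def)
    qed auto
    then show "\<delta> \<in> Cc" by (intro CcI[of \<delta> "{0}"]) (auto simp: \<delta>_def split: if_splits)
    show "\<forall>\<phi>. conv \<delta> \<phi> = \<phi>"
    proof (intro allI ext)
      fix \<phi> :: "'a \<Rightarrow> complex" and x :: 'a
      have "conv \<delta> \<phi> x = (LINT y|\<mu>. (if y = 0 then \<phi> x / m else 0))"
        unfolding convolution_def by (intro Bochner_Integration.integral_cong) (auto simp: \<delta>_def)
      then show "conv \<delta> \<phi> x = \<phi> x" using m0 by (simp add: sing)
    qed
    show "\<forall>\<phi>. conv \<phi> \<delta> = \<phi>"
    proof (intro allI ext)
      fix \<phi> :: "'a \<Rightarrow> complex" and x :: 'a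
      have "- y + x = 0 \<longleftrightarrow> y = x" for y by (metis add.left_inverse add.right_neutral add_minus_cancel)
      then have "conv \<phi> \<delta> x = (LINT y|\<mu>. (if y = x then \<phi> x / m else 0))"
        unfolding convolution_def by (intro Bochner_Integration.integral_cong) (auto simp: \<delta>_def)
      then show "conv \<phi> \<delta> x = \<phi> x" using m0 by (simp add: sing)
    qed
  qed
qed

lemma dense_range_Cc:
  assumes f: "f \<in> Cc"
    and c: "c > 0" "\<And>\<phi>. \<phi> \<in> Cc \<Longrightarrow> c * l2norm \<mu> \<phi> \<le> l2norm \<mu> (lop f z \<phi>)"
    and \<phi>: "\<phi> \<in> Cc" and e: "e > 0"
  shows "\<exists>\<psi>\<in>Cc. l2norm \<mu> (\<lambda>x. \<phi> x - lop f z \<psi> x) < e"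
proof (cases "z = 0")
  case False
  then show ?thesis by (rule dense_range_nonzero[OF f _ c \<phi> e])
next
  case z: True
  have "emeasure \<mu> {0} \<noteq> 0"
    using not_bounded_below_if_nondiscrete[OF f _ c(1)] c(2) by (auto simp: z lop_def)
  then obtain \<delta> where \<delta>: "\<delta> \<in> Cc" "\<forall>\<phi>. conv \<delta> \<phi> = \<phi>" "\<forall>\<phi>. conv \<phi> \<delta> = \<phi>"
    by (rule exists_unit_if_atom)
  show ?thesis
  \<comment> \<open>Both representatives are the unit, corresponding to r = 1; the difference to be
    represented is then zero, with preimage zero.\<close>
  proof (rule dense_range_of_representatives[OF f \<delta>(1) \<delta>(1) _ _ refl _ c \<phi> e])
    fix \<phi> :: "'a \<Rightarrow> complex"
    have "(\<lambda>x. \<phi> x - conv \<delta> \<phi> x) = lop f z (\<lambda>x. 0)"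
      using \<delta> by (simp add: z lop_def convolution_def fun_eq_iff)
    moreover have "(\<lambda>x::'a. 0) \<in> Cc" by (rule CcI[of _ "{}"]) auto
    ultimately show "\<exists>\<psi>\<in>Cc. (\<lambda>x. \<phi> x - conv \<delta> \<phi> x) = lop f z \<psi>" by blast
  qed (use \<delta> in \<open>auto simp: z lop_def rop_def\<close>)
qed

section \<open>Passage to square-integrable functions\<close>

text \<open>Inner regularity is available for open sets only, so \<open>K\<close> is chosen inside
  an open \<open>U\<close> containing \<open>A\<close> and need not lie in \<open>A\<close>. A
  Urysohn function for \<open>K\<close> and \<open>U\<close> differs from the indicator of
  \<open>A\<close> by at most 1, and only on \<open>U - A\<close> and \<open>U - K\<close>.\<close>

lemma Cc_dense_indicator:
  assumes A: "A \<in> sets borel" "emeasure \<mu> A < \<infinity>" and e: "e > 0"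
  shows "\<exists>\<phi>\<in>Cc. l2norm \<mu> (\<lambda>x. indicator A x - \<phi> x) < e"
proof -
  \<comment> \<open>The two exceptional sets have measure below \<open>d\<close> each, and two
    thirds of \<open>e\<^sup>2\<close> stay below \<open>e\<^sup>2\<close>.\<close>
  define d where "d = e\<^sup>2 / 3"
  have d: "d > 0" using e by (simp add: d_def)
  have "emeasure \<mu> A < emeasure \<mu> A + ennreal d"
    using A(2) d by (simp add: ennreal_add_left_cancel_less less_top)
  then obtain U where U: "open U" "A \<subseteq> U" "emeasure \<mu> U < emeasure \<mu> A + ennreal d"
    by (subst (asm) (1) outer_regular[OF A(1)]) (auto simp: INF_less_iff)
  have Ufin: "emeasure \<mu> U < \<infinity>" using U(3) by (rule less_trans) (use A(2) in simp)
  note Ue = emeasure_eq_ennreal_measure[OF Ufin[THEN less_imp_neq, simplified]]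
  note Ae = emeasure_eq_ennreal_measure[OF A(2)[THEN less_imp_neq, simplified]]
  have mU: "measure \<mu> U < measure \<mu> A + d"
    using U(3) d by (simp add: Ue Ae ennreal_less_iff flip: ennreal_plus)
  \<comment> \<open>Truncation by \<open>ennreal\<close> at zero makes the strict inequality fail
    for a null \<open>U\<close>; there the empty set serves.\<close>
  obtain K where K: "compact K" "K \<subseteq> U" "measure \<mu> U - d < measure \<mu> K"
  proof (cases "measure \<mu> U = 0")
    case True
    then show ?thesis using d by (intro that[of "{}"]) auto
  next
    case False
    then have "ennreal (measure \<mu> U - d) < emeasure \<mu> U"
      using d unfolding Ue by (intro ennreal_lessI) (auto simp: zero_less_measure_iff)
    then obtain K where K: "compact K" "K \<subseteq> U" "ennreal (measure \<mu> U - d) < emeasure \<mu> K"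
      unfolding inner_regular[OF U(1)] less_SUP_iff by blast
    have "emeasure \<mu> K = ennreal (measure \<mu> K)"
      using emeasure_compact_finite[OF K(1)] by (simp add: emeasure_eq_ennreal_measure less_top)
    then have "measure \<mu> U - d < measure \<mu> K"
      using K(3) by (metis ennreal_leI not_less)
    then show ?thesis using K(1,2) by (intro that)
  qed
  obtain g where g: "(\<lambda>x. complex_of_real (g x)) \<in> Cc" "\<And>x. 0 \<le> g x" "\<And>x. g x \<le> 1"
      "\<And>x. x \<in> K \<Longrightarrow> g x = 1" "\<And>x. x \<notin> U \<Longrightarrow> g x = 0"
    using Urysohn_locally_compact[OF locally_compact K(1) U(1) K(2)] by metis
  define \<phi> where "\<phi> x = complex_of_real (g x)" for x
  have \<phi>: "\<phi> \<in> Cc" using g(1) unfolding \<phi>_def .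
  have b: "(cmod (indicator A x - \<phi> x))\<^sup>2 \<le> indicator (U - A) x + indicator (U - K) x" for x
  proof -
    have 1: "indicator A x - \<phi> x = complex_of_real (indicator A x - g x)"
      by (simp add: \<phi>_def indicator_def)
    have 2: "(indicator A x - g x)\<^sup>2 \<le> 1"
      using g(2,3)[of x] by (subst abs_square_le_1) (auto simp: abs_le_iff indicator_def)
    have "(indicator A x - g x)\<^sup>2 \<le> indicator (U - A) x + indicator (U - K) x"
    proof (cases "x \<in> U - A \<or> x \<in> U - K")
      case True
      then show ?thesis using 2 by (auto simp: indicator_def split: if_splits)
    next
      case False
      then have "indicator A x = g x" using g(4,5)[of x] U(2) by (auto simp: indicator_def)
      then show ?thesis by simp
    qed
    then show ?thesis unfolding 1 by (simp only: norm_of_real power2_abs)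
  qed
  have sub: "emeasure \<mu> (U - A) < \<infinity>" "emeasure \<mu> (U - K) < \<infinity>"
    using Ufin U(1) by (auto intro: le_less_trans[OF emeasure_mono])
  have KB: "K \<in> sets borel" using K(1) by (rule borel_compact)
  have int: "integrable \<mu> (\<lambda>x. indicator (U - A) x + indicator (U - K) x :: real)"
    using sub U(1) A(1) KB by (intro Bochner_Integration.integrable_add integrable_real_indicator) auto
  have "(l2norm \<mu> (\<lambda>x. indicator A x - \<phi> x))\<^sup>2 \<le> (LINT x|\<mu>. indicator (U - A) x + indicator (U - K) x)"
    unfolding l2norm_power2 by (rule integral_mono'[OF int b]) simp
  also have "\<dots> = measure \<mu> (U - A) + measure \<mu> (U - K)"
    using sub U(1) A(1) KB by (subst Bochner_Integration.integral_add) (auto intro!: integrable_real_indicator)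
  also have "\<dots> = (measure \<mu> U - measure \<mu> A) + (measure \<mu> U - measure \<mu> K)"
    using Ufin U K(2) A KB by (simp add: measure_Diff less_top)
  also have "\<dots> < e\<^sup>2" using mU K(3) zero_less_power[OF e, of 2] unfolding d_def by linarith
  finally have "l2norm \<mu> (\<lambda>x. indicator A x - \<phi> x) < e" using e by (simp add: power2_less_imp_less)
  then show ?thesis using \<phi> by blast
qed

definition approximable :: "('a \<Rightarrow> complex) \<Rightarrow> bool" where
  "approximable h \<longleftrightarrow> h \<in> sq_integrable \<mu> \<and> (\<forall>e>0. \<exists>\<phi>\<in>Cc. l2norm \<mu> (\<lambda>x. h x - \<phi> x) < e)"

lemma approximable_add:
  assumes "approximable g" "approximable h" shows "approximable (\<lambda>x. g x + h x)"
  unfolding approximable_def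
proof (intro conjI allI impI)
  have sq: "g \<in> sq_integrable \<mu>" "h \<in> sq_integrable \<mu>" using assms by (auto simp: approximable_def)
  then show "(\<lambda>x. g x + h x) \<in> sq_integrable \<mu>" by (rule sq_integrable_add)
  fix e :: real assume "e > 0"
  then have "e / 2 > 0" by simp
  then obtain \<phi> \<psi> where *: "\<phi> \<in> Cc" "l2norm \<mu> (\<lambda>x. g x - \<phi> x) < e / 2" "\<psi> \<in> Cc" "l2norm \<mu> (\<lambda>x. h x - \<psi> x) < e / 2"
    using assms unfolding approximable_def by meson
  have "l2norm \<mu> (\<lambda>x. (g x - \<phi> x) + (h x - \<psi> x)) < e"
    using l2norm_triangle[OF sq_integrable_diff[OF sq(1) Cc_sq_integrable[OF *(1)]]
        sq_integrable_diff[OF sq(2) Cc_sq_integrable[OF *(3)]]] *(2,4) by linarith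
  then show "\<exists>\<phi>\<in>Cc. l2norm \<mu> (\<lambda>x. g x + h x - \<phi> x) < e"
    using * by (intro bexI[of _ "\<lambda>x. \<phi> x + \<psi> x"] Cc_add) (simp_all add: algebra_simps)
qed

lemma approximable_zero: "approximable (\<lambda>x. 0)"
proof -
  have 0: "(\<lambda>x::'a. 0) \<in> Cc" by (rule CcI[of _ "{}"]) auto
  then show ?thesis unfolding approximable_def
    by (auto simp: Cc_sq_integrable l2norm_def intro!: bexI[of _ "\<lambda>x. 0"])
qed

lemma approximable_scale:
  assumes "approximable h" shows "approximable (\<lambda>x. c * h x)"
proof (cases "c = 0")
  case False
  show ?thesis unfolding approximable_def
  proof (intro conjI allI impI)
    show "(\<lambda>x. c * h x) \<in> sq_integrable \<mu>"
      using assms by (auto simp: approximable_def intro: sq_integrable_scale)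
    fix e :: real assume "e > 0"
    then have "e / cmod c > 0" using False by simp
    then obtain \<phi> where *: "\<phi> \<in> Cc" "l2norm \<mu> (\<lambda>x. h x - \<phi> x) < e / cmod c"
      using assms unfolding approximable_def by meson
    have "l2norm \<mu> (\<lambda>x. c * (h x - \<phi> x)) < e"
      unfolding l2norm_scale using *(2) False by (simp add: pos_less_divide_eq mult.commute)
    then have "l2norm \<mu> (\<lambda>x. c * h x - c * \<phi> x) < e" by (simp only: right_diff_distrib)
    then show "\<exists>\<phi>\<in>Cc. l2norm \<mu> (\<lambda>x. c * h x - \<phi> x) < e"
      using Cc_scale[OF *(1)] by (intro bexI[of _ "\<lambda>x. c * \<phi> x"])
  qed
qed (simp add: approximable_zero)

lemma approximable_sum:
  assumes "finite I" "\<And>i. i \<in> I \<Longrightarrow> approximable (h i)" shows "approximable (\<lambda>x. \<Sum>i\<in>I. h i x)"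
  using assms by (induction I rule: finite_induct) (auto simp: approximable_zero approximable_add)

lemma approximable_indicator:
  assumes "A \<in> sets borel" "emeasure \<mu> A < \<infinity>" shows "approximable (indicator A)"
proof -
  have "integrable \<mu> (indicator A :: 'a \<Rightarrow> real)"
    using assms by (intro integrable_real_indicator) auto
  moreover have "(\<lambda>x. (cmod (indicator A x))\<^sup>2) = (indicator A :: 'a \<Rightarrow> real)"
    by (auto simp: indicator_def)
  ultimately have "indicator A \<in> sq_integrable \<mu>"
    using assms by (simp add: sq_integrable_def)
  then show ?thesis using Cc_dense_indicator[OF assms] by (simp add: approximable_def)
qed

text \<open>Simple functions bounded by \<open>2 * cmod (h x)\<close> converge to \<open>h\<close>
  in norm by dominated convergence, the squared error being at most
  \<open>9 * (cmod (h x))\<^sup>2\<close>. Each is a finite combination of indicators of sets of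
  finite measure.\<close>

lemma Cc_dense:
  assumes h: "h \<in> sq_integrable \<mu>" and e: "e > 0"
  shows "\<exists>\<phi>\<in>Cc. l2norm \<mu> (\<lambda>x. h x - \<phi> x) < e"
proof -
  note hD = sq_integrableD[OF h]
  note [measurable] = hD(1)
  obtain s where s: "\<And>i. simple_function \<mu> (s i)" "\<And>x. (\<lambda>i. s i x) \<longlonglongrightarrow> h x"
      "\<And>i x. cmod (s i x) \<le> 2 * cmod (h x)"
    using borel_measurable_implies_sequence_metric[OF hD(1), of 0] by (auto simp: dist_norm)
  have sm[measurable]: "s i \<in> borel_measurable \<mu>" for i by (rule borel_measurable_simple_function[OF s(1)])
  have ssq: "s i \<in> sq_integrable \<mu>" for i
  proof -
    have "integrable \<mu> (\<lambda>x. (cmod (s i x))\<^sup>2)"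
    proof (rule Bochner_Integration.integrable_bound)
      show "integrable \<mu> (\<lambda>x. 4 * (cmod (h x))\<^sup>2)" using hD(2) by simp
      have "(cmod (s i x))\<^sup>2 \<le> (2 * cmod (h x))\<^sup>2" for x by (intro power_mono s) simp
      then show "AE x in \<mu>. norm ((cmod (s i x))\<^sup>2) \<le> norm (4 * (cmod (h x))\<^sup>2)"
        by (simp add: power_mult_distrib)
    qed measurable
    then show ?thesis by (simp add: sq_integrable_def)
  qed
  have app: "approximable (s i)" for i
  proof -
    have fin: "finite (range (s i))" using simple_functionD(1)[OF s(1)] by simp
    \<comment> \<open>The value 0 is left out because its level set may have infinite measure; the
      level sets of the other values are finite in measure since \<open>s i\<close> is
      square-integrable.\<close>
    have eq: "s i = (\<lambda>x. \<Sum>y\<in>range (s i) - {0}. y * indicator (s i -` {y}) x)"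
    proof
      fix x
      have "(\<Sum>y\<in>range (s i) - {0}. y * indicator (s i -` {y}) x) = (\<Sum>y\<in>range (s i) - {0}. if y = s i x then s i x else 0)"
        by (intro sum.cong) (auto simp: indicator_def)
      also have "\<dots> = s i x" using fin by (simp add: sum.delta')
      finally show "s i x = (\<Sum>y\<in>range (s i) - {0}. y * indicator (s i -` {y}) x)" ..
    qed
    have "approximable (indicator (s i -` {y}))" if y: "y \<noteq> 0" for y
    proof (rule approximable_indicator)
      show A: "s i -` {y} \<in> sets borel" using measurable_sets[OF sm, of "{y}" i] by simp
      have "integrable \<mu> (indicator (s i -` {y}) :: 'a \<Rightarrow> real)"
      proof (rule Bochner_Integration.integrable_bound)
        show "integrable \<mu> (\<lambda>x. (cmod (s i x))\<^sup>2 / (cmod y)\<^sup>2)" using sq_integrableD(2)[OF ssq] by simp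
        show "AE x in \<mu>. norm (indicator (s i -` {y}) x :: real) \<le> norm ((cmod (s i x))\<^sup>2 / (cmod y)\<^sup>2)"
          using y by (auto simp: indicator_def)
      qed (use A in auto)
      then show "emeasure \<mu> (s i -` {y}) < \<infinity>" using A by (simp add: integrable_indicator_iff)
    qed
    then show ?thesis
      by (subst eq) (intro approximable_sum approximable_scale, use fin in auto)
  qed
  have "(\<lambda>i. LINT x|\<mu>. (cmod (h x - s i x))\<^sup>2) \<longlonglongrightarrow> (LINT x|\<mu>. 0)"
  proof (rule integral_dominated_convergence)
    show "integrable \<mu> (\<lambda>x. 9 * (cmod (h x))\<^sup>2)" using hD(2) by simp
    show "AE x in \<mu>. (\<lambda>i. (cmod (h x - s i x))\<^sup>2) \<longlonglongrightarrow> 0"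
    proof (rule AE_I2)
      fix x
      have "(\<lambda>i. (cmod (h x - s i x))\<^sup>2) \<longlonglongrightarrow> (cmod (h x - h x))\<^sup>2" by (intro tendsto_intros s)
      then show "(\<lambda>i. (cmod (h x - s i x))\<^sup>2) \<longlonglongrightarrow> 0" by simp
    qed
    show "AE x in \<mu>. norm ((cmod (h x - s i x))\<^sup>2) \<le> 9 * (cmod (h x))\<^sup>2" for i
    proof (rule AE_I2)
      fix x
      have "cmod (h x - s i x) \<le> 3 * cmod (h x)"
        using norm_triangle_ineq4[of "h x" "s i x"] s(3)[of i x] by linarith
      then have "(cmod (h x - s i x))\<^sup>2 \<le> (3 * cmod (h x))\<^sup>2" by (rule power_mono) simp
      then show "norm ((cmod (h x - s i x))\<^sup>2) \<le> 9 * (cmod (h x))\<^sup>2" by (simp add: power_mult_distrib)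
    qed
  qed measurable
  then have "(\<lambda>i. l2norm \<mu> (\<lambda>x. h x - s i x)) \<longlonglongrightarrow> 0"
    unfolding l2norm_def using tendsto_real_sqrt by fastforce
  then have "\<forall>\<^sub>F i in sequentially. l2norm \<mu> (\<lambda>x. h x - s i x) < e / 2"
    using e by (intro order_tendstoD(2)[of _ 0]) auto
  then obtain i where i: "l2norm \<mu> (\<lambda>x. h x - s i x) < e / 2" by (auto simp: eventually_sequentially)
  have "e / 2 > 0" using e by simp
  then obtain \<phi> where \<phi>: "\<phi> \<in> Cc" "l2norm \<mu> (\<lambda>x. s i x - \<phi> x) < e / 2"
    using app[of i] unfolding approximable_def by meson
  have "l2norm \<mu> (\<lambda>x. h x - \<phi> x) < e"
    using l2norm_diff_triangle[OF h ssq Cc_sq_integrable[OF \<phi>(1)], of i] i \<phi>(2) by linarith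
  then show ?thesis using \<phi>(1) by blast
qed

text \<open>Approximate \<open>h\<close> by \<open>\<phi> n\<close> in \<open>Cc\<close>. By
  \<open>conv_sup_bound\<close> the convolutions converge at every point, which gives measurability
  of the limit; Fatou then extends the bound known on \<open>Cc\<close> with the same
  constant.\<close>

lemma sq_integrable_conv:
  assumes f: "f \<in> Cc" and h: "h \<in> sq_integrable \<mu>"
  shows "conv f h \<in> sq_integrable \<mu>" "l2norm \<mu> (conv f h) \<le> l1norm f * l2norm \<mu> h"
proof -
  have "\<exists>\<phi>. \<phi> \<in> Cc \<and> l2norm \<mu> (\<lambda>x. h x - \<phi> x) < inverse (real (Suc n))" for n
    using Cc_dense[OF h, of "inverse (real (Suc n))"] by auto
  then obtain \<phi> where \<phi>: "\<And>n. \<phi> n \<in> Cc" "\<And>n. l2norm \<mu> (\<lambda>x. h x - \<phi> n x) < inverse (real (Suc n))" by metis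
  note fs = Cc_sq_integrable[OF f]
  note \<phi>s = Cc_sq_integrable[OF \<phi>(1)]
  have lim: "(\<lambda>n. conv f (\<phi> n) x) \<longlonglongrightarrow> conv f h x" for x
  proof -
    have le: "dist (conv f (\<phi> n) x) (conv f h x) \<le> l2norm \<mu> f * inverse (real (Suc n))" for n
    proof -
      have "dist (conv f (\<phi> n) x) (conv f h x) = cmod (conv f (\<lambda>x. h x - \<phi> n x) x)"
        by (simp add: conv_diff_right[OF fs h \<phi>s] dist_norm norm_minus_commute)
      also have "\<dots> \<le> l2norm \<mu> f * l2norm \<mu> (\<lambda>x. h x - \<phi> n x)"
        by (rule conv_sup_bound[OF fs sq_integrable_diff[OF h \<phi>s]])
      also have "\<dots> \<le> l2norm \<mu> f * inverse (real (Suc n))"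
        using \<phi>(2)[of n] by (intro mult_left_mono) auto
      finally show ?thesis .
    qed
    have l0: "(\<lambda>n. l2norm \<mu> f * inverse (real (Suc n))) \<longlonglongrightarrow> 0"
      using tendsto_mult_left[OF LIMSEQ_inverse_real_of_nat, of "l2norm \<mu> f"] by simp
    have "(\<lambda>n. dist (conv f (\<phi> n) x) (conv f h x)) \<longlonglongrightarrow> 0"
    proof (rule Lim_null_comparison[OF always_eventually l0], rule allI)
      show "norm (dist (conv f (\<phi> n) x) (conv f h x)) \<le> l2norm \<mu> f * inverse (real (Suc n))" for n
        using le[of n] by simp
    qed
    then show ?thesis by (rule tendsto_dist_iff[THEN iffD2])
  qed
  have meas: "conv f h \<in> borel_measurable \<mu>"
    by (rule borel_measurable_LIMSEQ_metric[OF Cc_measurable[OF Cc_conv[OF f \<phi>(1)]] lim])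
  have bnd: "l2norm \<mu> (conv f (\<phi> n)) \<le> l1norm f * (l2norm \<mu> h + inverse (real (Suc n)))" for n
  proof -
    have "l2norm \<mu> (\<phi> n) \<le> l2norm \<mu> h + l2norm \<mu> (\<lambda>x. h x - \<phi> n x)"
      using l2norm_triangle_diff[OF h sq_integrable_diff[OF h \<phi>s], of n] by simp
    then have "l2norm \<mu> (\<phi> n) \<le> l2norm \<mu> h + inverse (real (Suc n))" using \<phi>(2)[of n] by linarith
    then show ?thesis using l2norm_conv_le[OF f \<phi>(1), of n] mult_left_mono[of _ _ "l1norm f"]
      by (meson l1norm_nonneg order_trans)
  qed
  have "(\<lambda>n. l1norm f * (l2norm \<mu> h + inverse (real (Suc n)))) \<longlonglongrightarrow> l1norm f * (l2norm \<mu> h + 0)"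
    by (intro tendsto_intros LIMSEQ_inverse_real_of_nat)
  then have bl: "(\<lambda>n. l1norm f * (l2norm \<mu> h + inverse (real (Suc n)))) \<longlonglongrightarrow> l1norm f * l2norm \<mu> h" by simp
  note F = sq_integrable_Fatou[of "\<lambda>n. conv f (\<phi> n)", OF Cc_sq_integrable[OF Cc_conv[OF f \<phi>(1)]] meas AE_I2[OF lim] bnd bl]
  show "conv f h \<in> sq_integrable \<mu>" "l2norm \<mu> (conv f h) \<le> l1norm f * l2norm \<mu> h" by (rule F)+
qed

lemma sq_integrable_lop:
  assumes f: "f \<in> Cc" and h: "h \<in> sq_integrable \<mu>"
  shows "lop f z h \<in> sq_integrable \<mu>" "l2norm \<mu> (lop f z h) \<le> (l1norm f + cmod z) * l2norm \<mu> h"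
proof -
  note c = sq_integrable_conv[OF f h]
  show "lop f z h \<in> sq_integrable \<mu>" unfolding lop_def by (intro sq_integrable_diff c sq_integrable_scale h)
  have "l2norm \<mu> (lop f z h) \<le> l2norm \<mu> (conv f h) + l2norm \<mu> (\<lambda>x. z * h x)"
    unfolding lop_def by (intro l2norm_triangle_diff c sq_integrable_scale h)
  then show "l2norm \<mu> (lop f z h) \<le> (l1norm f + cmod z) * l2norm \<mu> h"
    using c(2) by (simp add: l2norm_scale algebra_simps)
qed

text \<open>Density gives \<open>\<psi> n\<close> in \<open>Cc\<close> whose images approach
  \<open>g\<close> with error \<open>(1/2) ^ n\<close>. The lower bound turns this into a fast
  Cauchy sequence with constant \<open>2 / c\<close>, and boundedness of \<open>lop f z\<close>
  identifies the image of its limit.\<close>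

lemma lop_surjective:
  assumes f: "f \<in> Cc"
    and c: "c > 0" "\<And>h. h \<in> sq_integrable \<mu> \<Longrightarrow> c * l2norm \<mu> h \<le> l2norm \<mu> (lop f z h)"
    and g: "g \<in> sq_integrable \<mu>"
  shows "\<exists>h\<in>sq_integrable \<mu>. AE x in \<mu>. lop f z h x = g x"
proof -
  note fs = Cc_sq_integrable[OF f]
  have "\<exists>\<psi>. \<psi> \<in> Cc \<and> l2norm \<mu> (\<lambda>x. g x - lop f z \<psi> x) < (1/2) ^ n" for n
  proof -
    have e: "(1/2) ^ n / 2 > (0::real)" by simp
    obtain \<phi> where \<phi>: "\<phi> \<in> Cc" "l2norm \<mu> (\<lambda>x. g x - \<phi> x) < (1/2) ^ n / 2" using Cc_dense[OF g e] by blast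
    obtain \<psi> where \<psi>: "\<psi> \<in> Cc" "l2norm \<mu> (\<lambda>x. \<phi> x - lop f z \<psi> x) < (1/2) ^ n / 2"
      using dense_range_Cc[OF f c(1) c(2)[OF Cc_sq_integrable] \<phi>(1) e] by blast
    have "l2norm \<mu> (\<lambda>x. g x - lop f z \<psi> x) < (1/2) ^ n"
      using l2norm_diff_triangle[OF g Cc_sq_integrable[OF \<phi>(1)] sq_integrable_lop(1)[OF f Cc_sq_integrable[OF \<psi>(1)]], of z]
        \<phi>(2) \<psi>(2) by linarith
    then show ?thesis using \<psi>(1) by blast
  qed
  then obtain \<psi> where \<psi>: "\<And>n. \<psi> n \<in> Cc" "\<And>n. l2norm \<mu> (\<lambda>x. g x - lop f z (\<psi> n) x) < (1/2) ^ n" by metis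
  note \<psi>s = Cc_sq_integrable[OF \<psi>(1)]
  note Ls = sq_integrable_lop(1)[OF f \<psi>s]
  have "l2norm \<mu> (\<lambda>x. \<psi> (Suc n) x - \<psi> n x) \<le> (2 / c) * (1/2) ^ n" for n
  proof -
    have "c * l2norm \<mu> (\<lambda>x. \<psi> (Suc n) x - \<psi> n x) \<le> l2norm \<mu> (\<lambda>x. lop f z (\<psi> (Suc n)) x - lop f z (\<psi> n) x)"
      using c(2)[OF sq_integrable_diff[OF \<psi>s \<psi>s], of "Suc n" n] by (simp add: lop_diff[OF fs \<psi>s \<psi>s])
    also have "\<dots> \<le> l2norm \<mu> (\<lambda>x. lop f z (\<psi> (Suc n)) x - g x) + l2norm \<mu> (\<lambda>x. g x - lop f z (\<psi> n) x)"
      by (rule l2norm_diff_triangle[OF Ls g Ls])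
    also have "\<dots> \<le> (1/2) ^ Suc n + (1/2) ^ n"
      using \<psi>(2)[of n] \<psi>(2)[of "Suc n"] l2norm_minus_commute[of \<mu> "lop f z (\<psi> (Suc n))" g] by linarith
    also have "\<dots> \<le> 2 * (1/2) ^ n" by simp
    finally show ?thesis using c(1) by (simp add: field_simps)
  qed
  then obtain h where h: "h \<in> sq_integrable \<mu>" "(\<lambda>n. l2norm \<mu> (\<lambda>x. h x - \<psi> n x)) \<longlonglongrightarrow> 0"
    by (rule sq_integrable_complete[OF \<psi>s])
  note Lh = sq_integrable_lop(1)[OF f h(1)]
  have "l2norm \<mu> (\<lambda>x. lop f z h x - g x) \<le> 0"
  proof (rule LIMSEQ_le_const)
    have "(\<lambda>n. (l1norm f + cmod z) * l2norm \<mu> (\<lambda>x. h x - \<psi> n x) + (1/2) ^ n) \<longlonglongrightarrow> (l1norm f + cmod z) * 0 + 0"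
      by (intro tendsto_intros h LIMSEQ_power_zero) simp
    then show "(\<lambda>n. (l1norm f + cmod z) * l2norm \<mu> (\<lambda>x. h x - \<psi> n x) + (1/2) ^ n) \<longlonglongrightarrow> 0" by simp
    have "l2norm \<mu> (\<lambda>x. lop f z h x - g x) \<le> (l1norm f + cmod z) * l2norm \<mu> (\<lambda>x. h x - \<psi> n x) + (1/2) ^ n" for n
    proof -
      have "l2norm \<mu> (\<lambda>x. lop f z h x - g x) \<le>
          l2norm \<mu> (\<lambda>x. lop f z h x - lop f z (\<psi> n) x) + l2norm \<mu> (\<lambda>x. lop f z (\<psi> n) x - g x)"
        by (rule l2norm_diff_triangle[OF Lh Ls g])
      moreover have "l2norm \<mu> (\<lambda>x. lop f z h x - lop f z (\<psi> n) x) \<le> (l1norm f + cmod z) * l2norm \<mu> (\<lambda>x. h x - \<psi> n x)"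
        using sq_integrable_lop(2)[OF f sq_integrable_diff[OF h(1) \<psi>s], of z] by (simp add: lop_diff[OF fs h(1) \<psi>s])
      moreover have "l2norm \<mu> (\<lambda>x. lop f z (\<psi> n) x - g x) < (1/2) ^ n"
        using \<psi>(2)[of n] l2norm_minus_commute[of \<mu> "lop f z (\<psi> n)" g] by linarith
      ultimately show ?thesis by linarith
    qed
    then show "\<exists>N. \<forall>n\<ge>N. l2norm \<mu> (\<lambda>x. lop f z h x - g x) \<le> (l1norm f + cmod z) * l2norm \<mu> (\<lambda>x. h x - \<psi> n x) + (1/2) ^ n"
      by blast
  qed
  then have "l2norm \<mu> (\<lambda>x. lop f z h x - g x) = 0" using l2norm_nonneg[of \<mu> "\<lambda>x. lop f z h x - g x"] by linarith
  then have "AE x in \<mu>. lop f z h x - g x = 0"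
    using l2norm_eq_0_iff[OF sq_integrable_diff[OF Lh g]] by simp
  then have "AE x in \<mu>. lop f z h x = g x" by simp
  with h(1) show ?thesis by blast
qed

section \<open>Classes modulo null sets and the spectrum\<close>

lemma lambda2_class:
  assumes f: "f \<in> Cc" and h: "h \<in> sq_integrable \<mu>"
  shows "lambda2 \<mu> f (L2_class \<mu> h) = L2_class \<mu> (conv f h)"
proof -
  have eq: "conv f h' = conv f h" if "h' \<in> L2_class \<mu> h" for h'
  proof -
    have "h' \<in> sq_integrable \<mu>" "AE x in \<mu>. h x = h' x" using that mem_L2_class_iff[OF h] by blast+
    then have "conv f h = conv f h'"
      by (intro conv_cong_AE Cc_measurable f sq_integrableD h)
    then show ?thesis ..
  qed
  have "lambda2 \<mu> f (L2_class \<mu> h) = (\<Union>h'\<in>L2_class \<mu> h. L2_class \<mu> (conv f h))"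
    unfolding lambda2_def by (rule SUP_cong[OF refl]) (simp only: eq)
  also have "\<dots> = L2_class \<mu> (conv f h)"
    using L2_class_self[OF h] by (subst UN_constant) (simp only: if_False empty_iff split: if_splits, blast)
  finally show ?thesis .
qed

lemma shifted_class:
  assumes f: "f \<in> Cc" and h: "h \<in> sq_integrable \<mu>"
  shows "shifted \<mu> (lambda2 \<mu> f) z (L2_class \<mu> h) = L2_class \<mu> (lop f z h)"
proof -
  have "shifted \<mu> (lambda2 \<mu> f) z (L2_class \<mu> h) = L2_class \<mu> (\<lambda>x. conv f h x + (- 1) * (z * h x))"
    unfolding shifted_def L2_diff_def
    by (simp only: lambda2_class L2_scale_class L2_add_class sq_integrable_scale sq_integrable_conv assms)
  then show ?thesis by (simp add: lop_def)
qed

text \<open>If every constant \<open>inverse (Suc n)\<close> fails, the strict inequalities produce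
  functions of nonzero norm, and normalising them gives a sequence witnessing an approximate
  eigenvalue.\<close>

lemma bounded_below_if_not_approximate_eigenvalue:
  assumes f: "f \<in> Cc" and na: "\<not> approximate_eigenvalue \<mu> (lambda2 \<mu> f) z"
  obtains c where "c > 0" "\<forall>h\<in>sq_integrable \<mu>. c * l2norm \<mu> h \<le> l2norm \<mu> (lop f z h)"
proof (rule ccontr)
  assume "\<not> thesis"
  then have "\<exists>h. h \<in> sq_integrable \<mu> \<and> l2norm \<mu> (lop f z h) < inverse (real (Suc n)) * l2norm \<mu> h" for n
  proof -
    have "inverse (real (Suc n)) > 0" by simp
    with \<open>\<not> thesis\<close> that[of "inverse (real (Suc n))"]
    have "\<not> (\<forall>h\<in>sq_integrable \<mu>. inverse (real (Suc n)) * l2norm \<mu> h \<le> l2norm \<mu> (lop f z h))"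
      by blast
    then show ?thesis unfolding Ball_def not_le[symmetric] by blast
  qed
  then obtain h where h: "\<And>n. h n \<in> sq_integrable \<mu>"
      "\<And>n. l2norm \<mu> (lop f z (h n)) < inverse (real (Suc n)) * l2norm \<mu> (h n)" by metis
  have pos: "l2norm \<mu> (h n) > 0" for n
    using h(2)[of n] l2norm_nonneg[of \<mu> "h n"] l2norm_nonneg[of \<mu> "lop f z (h n)"]
    by (cases "l2norm \<mu> (h n) = 0") (simp, linarith)
  define u where "u n = (\<lambda>x. complex_of_real (1 / l2norm \<mu> (h n)) * h n x)" for n
  have u: "u n \<in> sq_integrable \<mu>" for n unfolding u_def by (rule sq_integrable_scale[OF h(1)])
  have nu: "l2norm \<mu> (u n) = 1" for n
    unfolding u_def l2norm_scale using pos[of n] by (simp add: norm_divide)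
  have Lu: "l2norm \<mu> (lop f z (u n)) < inverse (real (Suc n))" for n
    unfolding u_def lop_scale l2norm_scale using pos[of n] h(2)[of n]
    by (simp add: norm_divide divide_less_eq)
  have "approximate_eigenvalue \<mu> (lambda2 \<mu> f) z"
    unfolding approximate_eigenvalue_def
  proof (intro exI[of _ "\<lambda>n. L2_class \<mu> (u n)"] conjI allI)
    show "L2_class \<mu> (u n) \<in> L2_space \<mu>" for n
      unfolding L2_space_def L2_class_def by (rule quotientI[OF u])
    show "L2_norm \<mu> (L2_class \<mu> (u n)) = 1" for n
      using nu by (simp add: L2_norm_class[OF u] l2norm_def)
    have "L2_norm \<mu> (shifted \<mu> (lambda2 \<mu> f) z (L2_class \<mu> (u n))) = l2norm \<mu> (lop f z (u n))" for n
      unfolding shifted_class[OF f u] L2_norm_class[OF sq_integrable_lop(1)[OF f u]] l2norm_def ..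
    moreover have "(\<lambda>n. l2norm \<mu> (lop f z (u n))) \<longlonglongrightarrow> 0"
    proof (rule Lim_null_comparison[OF always_eventually LIMSEQ_inverse_real_of_nat], rule allI)
      show "norm (l2norm \<mu> (lop f z (u n))) \<le> inverse (real (Suc n))" for n
        using Lu[of n] by simp
    qed
    ultimately show "(\<lambda>n. L2_norm \<mu> (shifted \<mu> (lambda2 \<mu> f) z (L2_class \<mu> (u n)))) \<longlonglongrightarrow> 0" by simp
  qed
  with na show False by contradiction
qed

text \<open>On classes the lower bound gives injectivity and \<open>lop_surjective\<close> gives
  surjectivity. The set-theoretic inverse inherits linearity from the shifted operator, and the
  lower bound read backwards bounds it by \<open>1 / c\<close>.\<close>

lemma spectrum_approximate_eigenvalue:
  assumes f: "f \<in> Cc" and z: "z \<in> L2_spectrum \<mu> (lambda2 \<mu> f)"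
  shows "approximate_eigenvalue \<mu> (lambda2 \<mu> f) z"
proof (rule ccontr)
  assume "\<not> ?thesis"
  then obtain c where c: "c > 0" "\<forall>h\<in>sq_integrable \<mu>. c * l2norm \<mu> h \<le> l2norm \<mu> (lop f z h)"
    by (rule bounded_below_if_not_approximate_eigenvalue[OF f])
  note fs = Cc_sq_integrable[OF f]
  define X where "X = L2_space \<mu>"
  define A where "A = shifted \<mu> (lambda2 \<mu> f) z"
  have X: "X = L2_class \<mu> ` sq_integrable \<mu>"
    unfolding X_def L2_space_def quotient_def L2_class_def by auto
  have A: "A (L2_class \<mu> h) = L2_class \<mu> (lop f z h)" if "h \<in> sq_integrable \<mu>" for h
    unfolding A_def by (rule shifted_class[OF f that])
  have norm: "L2_norm \<mu> (L2_class \<mu> h) = l2norm \<mu> h" if "h \<in> sq_integrable \<mu>" for h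
    unfolding l2norm_def by (rule L2_norm_class[OF that])
  note L = sq_integrable_lop(1)[OF f]
  have inj: "inj_on A X"
  proof (rule inj_onI)
    fix a b assume "a \<in> X" "b \<in> X" and eq: "A a = A b"
    then obtain g h where gh: "g \<in> sq_integrable \<mu>" "h \<in> sq_integrable \<mu>" "a = L2_class \<mu> g" "b = L2_class \<mu> h"
      by (auto simp: X)
    have "lop f z h \<in> L2_class \<mu> (lop f z g)"
      using eq A gh L2_class_self[OF L[OF gh(2)]] by simp
    then have "AE x in \<mu>. lop f z g x = lop f z h x" using mem_L2_class_iff[OF L[OF gh(1)]] by blast
    then have "AE x in \<mu>. lop f z (\<lambda>x. g x - h x) x = 0"
      unfolding lop_diff[OF fs gh(1,2)] by simp
    then have "l2norm \<mu> (lop f z (\<lambda>x. g x - h x)) = 0"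
      using l2norm_eq_0_iff[OF L[OF sq_integrable_diff[OF gh(1,2)]]] by blast
    then have "c * l2norm \<mu> (\<lambda>x. g x - h x) \<le> 0" using c(2) sq_integrable_diff[OF gh(1,2)] by metis
    then have "l2norm \<mu> (\<lambda>x. g x - h x) = 0"
      using c(1) l2norm_nonneg[of \<mu> "\<lambda>x. g x - h x"] by (simp add: mult_le_0_iff)
    then have "AE x in \<mu>. g x = h x"
      using l2norm_eq_0_iff[OF sq_integrable_diff[OF gh(1,2)]] by simp
    then show "a = b" unfolding gh(3,4) by (rule L2_class_eqI[OF gh(1,2)])
  qed
  have surj: "A ` X = X"
  proof
    show "A ` X \<subseteq> X" using A L by (auto simp: X)
    show "X \<subseteq> A ` X"
    proof
      fix b assume "b \<in> X"
      then obtain g where g: "g \<in> sq_integrable \<mu>" "b = L2_class \<mu> g" by (auto simp: X)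
      obtain h where h: "h \<in> sq_integrable \<mu>" "AE x in \<mu>. lop f z h x = g x"
        using lop_surjective[OF f c(1) c(2)[rule_format] g(1)] by blast
      have "A (L2_class \<mu> h) = b"
        unfolding A[OF h(1)] g(2) by (rule L2_class_eqI[OF L[OF h(1)] g(1) h(2)])
      then show "b \<in> A ` X" using h(1) by (auto simp: X)
    qed
  qed
  define S where "S = the_inv_into X A"
  have SA: "S (A a) = a" if "a \<in> X" for a unfolding S_def by (rule the_inv_into_f_f[OF inj that])
  have AS: "A (S b) = b" "S b \<in> X" if "b \<in> X" for b
    using f_the_inv_into_f[OF inj, of b] the_inv_into_into[OF inj, of b X] that surj by (auto simp: S_def)
  have add: "L2_add \<mu> a b \<in> X" "A (L2_add \<mu> a b) = L2_add \<mu> (A a) (A b)" if "a \<in> X" "b \<in> X" for a b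
    using that by (auto simp: X L2_add_class A sq_integrable_add L lop_add[OF fs])
  have scale: "L2_scale \<mu> k a \<in> X" "A (L2_scale \<mu> k a) = L2_scale \<mu> k (A a)" if "a \<in> X" for k a
    using that by (auto simp: X L2_scale_class A sq_integrable_scale L lop_scale)
  have "bounded_L2_operator \<mu> S"
    unfolding bounded_L2_operator_def X_def[symmetric]
  proof (intro conjI ballI allI)
    show "S a \<in> X" if "a \<in> X" for a by (rule AS(2)[OF that])
    show "S (L2_add \<mu> a b) = L2_add \<mu> (S a) (S b)" if "a \<in> X" "b \<in> X" for a b
      using SA[OF add(1)[OF AS(2)[OF that(1)] AS(2)[OF that(2)]]] by (simp add: add AS that)
    show "S (L2_scale \<mu> k a) = L2_scale \<mu> k (S a)" if "a \<in> X" for k a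
      using SA[OF scale(1)[OF AS(2)[OF that]], of k] by (simp add: scale AS that)
    have "L2_norm \<mu> (S b) \<le> (1 / c) * L2_norm \<mu> b" if b: "b \<in> X" for b
    proof -
      obtain h where h: "h \<in> sq_integrable \<mu>" "S b = L2_class \<mu> h" using AS(2)[OF b] by (auto simp: X)
      have "b = L2_class \<mu> (lop f z h)" using AS(1)[OF b] A[OF h(1)] h(2) by simp
      then have "c * L2_norm \<mu> (S b) \<le> L2_norm \<mu> b" using c(2) h by (simp add: norm L)
      then show ?thesis using c(1) by (simp add: field_simps)
    qed
    then show "\<exists>C. \<forall>a\<in>X. L2_norm \<mu> (S a) \<le> C * L2_norm \<mu> a" by blast
  qed
  moreover have "\<forall>a\<in>L2_space \<mu>. S (shifted \<mu> (lambda2 \<mu> f) z a) = a \<and> shifted \<mu> (lambda2 \<mu> f) z (S a) = a"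
    using SA AS(1) unfolding X_def A_def by blast
  ultimately show False using z unfolding L2_spectrum_def by blast
qed

end

theorem corollary1p2:
  fixes \<mu> :: "'a::{topological_group_add,t2_space} measure"
    and f :: "'a \<Rightarrow> complex"
  assumes "locally_compact_space (euclidean :: 'a topology)"
    and "left_haar_measure \<mu>"
    and "unimodular TYPE('a)"
    and "f \<in> Cc"
  shows "\<forall>z\<in>L2_spectrum \<mu> (lambda2 \<mu> f). approximate_eigenvalue \<mu> (lambda2 \<mu> f) z"
proof -
  interpret unimodular_haar \<mu>
    using assms by unfold_locales (auto simp: unimodular_def)
  show ?thesis using spectrum_approximate_eigenvalue[OF assms(4)] by blast
qed

end
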